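(* Let $T>0$. Suppose that (A2) and (A3) of the context hold and that i) $\zeta$ satisfies (A1) and admits a lower convex envelope $\zeta_c$, with $\zeta_c(u)\le\zeta(u)$ for all $u\in\mathbb{R}_+$ and $\zeta_c'(0)>0$; ii) $f$ is a Lipschitz function such that $\partial_t f(t)>0$ for a.e. $t\in(0,T)$; iii) $f$ and $\beta$ are such that $\beta_{\max}<\zeta_c'(0)\,f_{\min}$, where $f_{\min}$ is the infimum of $f$ on $(0,T)$; iv) $v_I(a)\ge0$ for a.e. $a\in\mathbb{R}_+$. Then, if the solution $(\rho,v)$ of the fully coupled system (S) of the context exists until a finite time $T_0$, this time cannot be greater than $$t_0:=\frac{\varepsilon}{\beta_{\min}+\zeta_c(0)}\,\ln\left(1+\frac{\mu_0(0)\,(\beta_{\min}+\zeta_c(0))}{\zeta_c'(0)f_{\min}-\beta_{\max}}\right),$$ for which $$\mu_0(t_0)\le0 .$$ Moreover, on $(0,t_0)\times\mathbb{R}_+$, one has the lower bound on the profile of $v$ $$v(t,a)\ge\varepsilon\,\gamma_6\,\ln\left(1+\frac{\min(t,\varepsilon a)}{t_0-t}\right),\qquad \gamma_6:=\frac{t_0\,\inf_{t\in(0,t_0)}\partial_t f(t)}{\mu_0(0)} .$$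
   Context: $\mathbb{R}_+=[0,\infty)$; $\varepsilon>0$ is fixed; $\omega(a)=1/(1+a)$. For $T>0$, $X_T$ is the set of $u\in L^\infty_{loc}((0,T)\times\mathbb{R}_+)$ with $\sup_{t\in(0,T)}\|u(t,\cdot)\,\omega\|_{L^\infty(\mathbb{R}_+)}<\infty$; $L^\infty(\mathbb{R}_+,\omega)$ is the set of $v$ with $v\omega\in L^\infty(\mathbb{R}_+)$. The lower convex envelope of $\zeta$ on $\mathbb{R}_+$ is the largest convex function on $\mathbb{R}_+$ that is $\le\zeta$; $\zeta_c'(0)$ is its (right) derivative at $0$. (A1) $\zeta(u)\ge\zeta_{\min}>0$ and $|\zeta'(u)|\le\zeta_{\rm Lip}$ for all $u\in\mathbb{R}$; the real-valued function $f$ is Lipschitz on $[0,T]$ for any fixed $T>0$. (A2) $\rho_I\in L^\infty(\mathbb{R}_+)$, $\rho_I\ge0$ a.e., $0<\int_0^\infty\rho_I\,da<1$, and $0<\int_0^\infty a^p\rho_I(a)\,da\le c_p<\infty$ for $p=1,2$. (A3) $\beta$ is a continuous function of $t$ with $0<\beta_{\min}\le\beta(t)\le\beta_{\max}$ for all positive times. Throughout, $v_I\in L^\infty(\mathbb{R}_+,\omega)$ and $f(0)=\int_0^\infty\rho_I(a)v_I(a)\,da$. Fully coupled system (S), for $t>0$, $a>0$, with $\mu_0(t)=\int_0^\infty\rho(t,a)\,da$ (so $\mu_0(0)=\int_0^\infty\rho_I\,da$): $$\varepsilon\partial_t\rho+\partial_a\rho+\zeta(v)\rho=0,\quad \rho(t,0)=\beta(t)(1-\mu_0(t)),\quad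 \rho(0,a)=\rho_I(a),$$ $$\varepsilon\partial_t v+\partial_a v=\frac{1}{\mu_0(t)}\left(\varepsilon\partial_t f+\int_0^\infty\zeta(v)\,v\,\rho\,d\tilde a\right),\quad v(t,0)=0,\quad v(0,a)=v_I(a).$$ Solutions ($\rho$ continuous in time with values in $L^1(\mathbb{R}_+)$, $v$ in $X_{T'}$ for times $T'$ before the time of existence) are understood in the sense of characteristics, i.e. the equations are integrated along the lines $t-\varepsilon a=$ const.
   Formalization: The printed lower bound on v fails for some data with ε>1; it is asserted for ε≤1, and for every ε>0 with γ₆ in place of εγ₆. It is also assumed that min(T₀,t₀)≤T, as f is controlled only on (0,T); μ₀(t₀)≤0 is read as a left limit when T₀=t₀. *)

theory Defs
  imports "HOL-Analysis.Analysis"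
begin

text \<open>Functions of time and age are curried, \<open>u t a\<close>.  Elements of Lebesgue spaces are represented
  by Borel functions; their values at negative ages are irrelevant.\<close>

definition \<omega> :: "real \<Rightarrow> real" where
  "\<omega> a = 1 / (1 + a)"

definition ess_bounded :: "(real \<Rightarrow> real) \<Rightarrow> bool" where
  "ess_bounded u \<longleftrightarrow>
     set_borel_measurable borel {0..} u \<and>
     (\<exists>C. AE a in lborel. 0 \<le> a \<longrightarrow> \<bar>u a\<bar> \<le> C)"

definition weighted_ess_bounded :: "(real \<Rightarrow> real) \<Rightarrow> bool" where
  "weighted_ess_bounded u \<longleftrightarrow> ess_bounded (\<lambda>a. u a * \<omega> a)"

text \<open>The space \<open>X\<^sub>T\<close>.  Local essential boundedness on \<open>(0,T) \<times> [0,\<infinity>)\<close> follows from measurability and the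
  uniform weighted bound.\<close>

definition space_X :: "real \<Rightarrow> (real \<Rightarrow> real \<Rightarrow> real) set" where
  "space_X T = {u. set_borel_measurable borel ({0<..<T} \<times> {0..}) (\<lambda>(t, a). u t a) \<and>
     (\<exists>C. \<forall>t\<in>{0<..<T}. AE a in lborel. 0 \<le> a \<longrightarrow> \<bar>u t a * \<omega> a\<bar> \<le> C)}"

definition continuous_L1 :: "real \<Rightarrow> (real \<Rightarrow> real \<Rightarrow> real) \<Rightarrow> bool" where
  "continuous_L1 T u \<longleftrightarrow>
     set_borel_measurable borel ({0<..<T} \<times> {0..}) (\<lambda>(t, a). u t a) \<and>
     (\<forall>t\<in>{0..<T}. set_integrable lborel {0..} (u t)) \<and>
     (\<forall>t\<in>{0..<T}. ((\<lambda>s. LBINT a:{0..}. \<bar>u s a - u t a\<bar>) \<longlongrightarrow> 0) (at t within {0..<T}))"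

definition ess_inf_on :: "real set \<Rightarrow> (real \<Rightarrow> real) \<Rightarrow> real" where
  "ess_inf_on S g = Sup {c. AE t in lborel. t \<in> S \<longrightarrow> c \<le> g t}"

definition lower_convex_envelope :: "(real \<Rightarrow> real) \<Rightarrow> (real \<Rightarrow> real) \<Rightarrow> bool" where
  "lower_convex_envelope \<zeta> \<zeta>c \<longleftrightarrow>
     convex_on {0..} \<zeta>c \<and> (\<forall>u\<ge>0. \<zeta>c u \<le> \<zeta> u) \<and>
     (\<forall>h. convex_on {0..} h \<and> (\<forall>u\<ge>0. h u \<le> \<zeta> u) \<longrightarrow> (\<forall>u\<ge>0. h u \<le> \<zeta>c u))"

definition assumption_A1 ::
  "(real \<Rightarrow> real) \<Rightarrow> real \<Rightarrow> real \<Rightarrow> (real \<Rightarrow> real) \<Rightarrow> bool" where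
  "assumption_A1 \<zeta> \<zeta>min \<zeta>Lip f \<longleftrightarrow>
     0 < \<zeta>min \<and> (\<forall>u. \<zeta>min \<le> \<zeta> u) \<and>
     (\<forall>u. \<zeta> differentiable (at u) \<and> \<bar>deriv \<zeta> u\<bar> \<le> \<zeta>Lip) \<and>
     (\<forall>S>0. \<exists>L. L-lipschitz_on {0..S} f)"

definition assumption_A2 :: "(real \<Rightarrow> real) \<Rightarrow> (nat \<Rightarrow> real) \<Rightarrow> bool" where
  "assumption_A2 \<rho>I c \<longleftrightarrow>
     ess_bounded \<rho>I \<and> (AE a in lborel. 0 \<le> a \<longrightarrow> 0 \<le> \<rho>I a) \<and>
     set_integrable lborel {0..} \<rho>I \<and>
     0 < (LBINT a:{0..}. \<rho>I a) \<and> (LBINT a:{0..}. \<rho>I a) < 1 \<and>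
     (\<forall>p\<in>{1, 2}. set_integrable lborel {0..} (\<lambda>a. a ^ p * \<rho>I a) \<and>
        0 < (LBINT a:{0..}. a ^ p * \<rho>I a) \<and> (LBINT a:{0..}. a ^ p * \<rho>I a) \<le> c p)"

definition assumption_A3 :: "(real \<Rightarrow> real) \<Rightarrow> real \<Rightarrow> real \<Rightarrow> bool" where
  "assumption_A3 \<beta> \<beta>min \<beta>max \<longleftrightarrow>
     continuous_on {0..} \<beta> \<and> 0 < \<beta>min \<and> (\<forall>t>0. \<beta>min \<le> \<beta> t \<and> \<beta> t \<le> \<beta>max)"

definition \<mu>0 :: "(real \<Rightarrow> real \<Rightarrow> real) \<Rightarrow> real \<Rightarrow> real" where
  "\<mu>0 \<rho> t = (LBINT a:{0..}. \<rho> t a)"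

text \<open>The right-hand side of the equation for \<open>v\<close>, a function of time only.\<close>

definition v_source ::
  "real \<Rightarrow> (real \<Rightarrow> real) \<Rightarrow> (real \<Rightarrow> real) \<Rightarrow>
   (real \<Rightarrow> real \<Rightarrow> real) \<Rightarrow> (real \<Rightarrow> real \<Rightarrow> real) \<Rightarrow> real \<Rightarrow> real" where
  "v_source \<epsilon> \<zeta> f \<rho> v t =
     1 / \<mu>0 \<rho> t * (\<epsilon> * deriv f t + (LBINT a:{0..}. \<zeta> (v t a) * v t a * \<rho> t a))"

text \<open>Solutions on \<open>[0,T\<^sub>0)\<close> in the sense of characteristics.  Since \<open>\<epsilon> \<partial>\<^sub>t + \<partial>\<^sub>a\<close> is the derivative
  along \<open>s \<mapsto> (t + \<epsilon> s, a + s)\<close>, both equations are integrated over the part of the line through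
  \<open>(t, a)\<close> that precedes this point.  The line is followed backwards for the length \<open>min a (t / \<epsilon>)\<close>,
  down to the boundary \<open>a = 0\<close> if \<open>\<epsilon> a < t\<close> and down to \<open>t = 0\<close> otherwise.  The integrability
  clauses and \<open>\<mu>\<^sub>0 \<noteq> 0\<close> ensure that the integrals and the quotient in the system have their usual
  meaning, as both are total functions in HOL.\<close>

definition char_solution ::
  "real \<Rightarrow> (real \<Rightarrow> real) \<Rightarrow> (real \<Rightarrow> real) \<Rightarrow> (real \<Rightarrow> real) \<Rightarrow> (real \<Rightarrow> real) \<Rightarrow> (real \<Rightarrow> real) \<Rightarrow>
   real \<Rightarrow> (real \<Rightarrow> real \<Rightarrow> real) \<Rightarrow> (real \<Rightarrow> real \<Rightarrow> real) \<Rightarrow> bool" where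
  "char_solution \<epsilon> \<zeta> \<beta> f \<rho>I vI T0 \<rho> v \<longleftrightarrow>
     0 < T0 \<and>
     continuous_L1 T0 \<rho> \<and>
     (\<forall>T'\<in>{0<..<T0}. v \<in> space_X T') \<and>
     (\<forall>t\<in>{0..<T0}. \<mu>0 \<rho> t \<noteq> 0) \<and>
     (\<forall>t\<in>{0<..<T0}. set_integrable lborel {0..} (\<lambda>a. \<zeta> (v t a) * v t a * \<rho> t a)) \<and>
     (\<forall>t\<in>{0..<T0}. AE a in lborel. 0 < a \<longrightarrow>
        set_integrable lborel {0..min a (t / \<epsilon>)}
          (\<lambda>s. \<zeta> (v (t - \<epsilon> * s) (a - s)) * \<rho> (t - \<epsilon> * s) (a - s)) \<and>
        \<rho> t a =
          (if \<epsilon> * a < t then \<beta> (t - \<epsilon> * a) * (1 - \<mu>0 \<rho> (t - \<epsilon> * a)) else \<rho>I (a - t / \<epsilon>))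
          - (LBINT s:{0..min a (t / \<epsilon>)}.
               \<zeta> (v (t - \<epsilon> * s) (a - s)) * \<rho> (t - \<epsilon> * s) (a - s))) \<and>
     (\<forall>t\<in>{0..<T0}. AE a in lborel. 0 < a \<longrightarrow>
        set_integrable lborel {0..min a (t / \<epsilon>)} (\<lambda>s. v_source \<epsilon> \<zeta> f \<rho> v (t - \<epsilon> * s)) \<and>
        v t a =
          (if \<epsilon> * a < t then 0 else vI (a - t / \<epsilon>))
          + (LBINT s:{0..min a (t / \<epsilon>)}. v_source \<epsilon> \<zeta> f \<rho> v (t - \<epsilon> * s)))"

end

theory Submission
  imports Defs
begin

text \<open>
  Along the characteristics the equation for \<open>\<rho>\<close> is a linear Volterra equation, so \<open>\<rho> \<ge> 0\<close> as long as
  \<open>\<mu>\<^sub>0 \<le> 1\<close>, and this persists because \<open>\<epsilon> \<mu>\<^sub>0' = \<beta> (1 - \<mu>\<^sub>0) - \<integral> \<zeta>(v) \<rho>\<close>.  Write \<open>S\<close> for the right-hand side of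
  the equation for \<open>v\<close>, which depends on time only, and \<open>V\<close> for its primitive divided by \<open>\<epsilon>\<close>: then \<open>v - V\<close> is
  constant along characteristics.  Since \<open>v\<close> is bounded below by minus the integral of \<open>S\<^sup>-\<close>, and \<open>S\<close> in turn by a
  multiple of the lower bound of \<open>v\<close>, Gronwall gives \<open>v \<ge> 0\<close>.  Testing the equation for \<open>\<rho>\<close> with \<open>v - V\<close> and
  applying the product rule to \<open>V \<mu>\<^sub>0\<close> yields \<open>\<integral> \<rho> v = f\<close>.

  Convexity gives \<open>\<zeta>(v) \<ge> \<zeta>\<^sub>c(0) + \<zeta>\<^sub>c'(0) v\<close>, hence \<open>\<epsilon> \<mu>\<^sub>0' \<le> - k \<mu>\<^sub>0 - D\<close> with \<open>k = \<beta>\<^sub>m\<^sub>i\<^sub>n + \<zeta>\<^sub>c(0)\<close> and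
  \<open>D = \<zeta>\<^sub>c'(0) f\<^sub>m\<^sub>i\<^sub>n - \<beta>\<^sub>m\<^sub>a\<^sub>x\<close>.  The solution of the corresponding equation with the same initial value vanishes
  at \<open>t\<^sub>0\<close> and is convex, so that \<open>\<mu>\<^sub>0(t) \<le> \<mu>\<^sub>0(0) (1 - t / t\<^sub>0)\<close>.  Then \<open>S(t) \<ge> \<epsilon> f'(t) / \<mu>\<^sub>0(t) \<ge> \<epsilon> \<gamma>\<^sub>6 / (t\<^sub>0 - t)\<close>,
  and integration along the characteristics gives the logarithm.
\<close>

subsection \<open>Integrals, Gronwall and Volterra inequalities\<close>

lemma set_integral_cong_AE_on:
  assumes "set_borel_measurable M A f" "set_borel_measurable M A g"
    and "AE x in M. x \<in> A \<longrightarrow> f x = g x"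
  shows "set_integrable M A f \<longleftrightarrow> set_integrable M A g"
    and "(LINT x:A|M. f x) = (LINT x:A|M. g x)"
proof -
  have "AE x in M. indicator A x *\<^sub>R f x = indicator A x *\<^sub>R g x"
    using assms(3) by eventually_elim (auto simp: indicator_def)
  then show "set_integrable M A f \<longleftrightarrow> set_integrable M A g" "(LINT x:A|M. f x) = (LINT x:A|M. g x)"
    using assms(1,2) unfolding set_integrable_def set_lebesgue_integral_def set_borel_measurable_def
    by - (rule integrable_cong_AE integral_cong_AE; assumption)+
qed

lemma set_integral_Icc_split:
  fixes f :: "real \<Rightarrow> real"
  assumes "set_integrable lborel {a..b} f" "a \<le> c" "c \<le> b"
  shows "(LBINT x:{a..b}. f x) = (LBINT x:{a..c}. f x) + (LBINT x:{c..b}. f x)"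
proof -
  have "{a..b} = {a..c} \<union> {c<..b}" using assms by auto
  then have "(LBINT x:{a..b}. f x) = (LBINT x:{a..c}. f x) + (LBINT x:{c<..b}. f x)"
    using assms by (simp add: set_integral_Un set_integrable_subset[OF assms(1)] disjoint_iff)
  moreover have "(LBINT x:{c<..b}. f x) = (LBINT x:{c..b}. f x)"
  proof (rule set_integral_cong_set)
    show "set_borel_measurable lborel {c<..b} f" "set_borel_measurable lborel {c..b} f"
      unfolding set_borel_measurable_def
      by (rule borel_measurable_integrable, fold set_integrable_def,
          rule set_integrable_subset[OF assms(1)]; use assms in auto)+
    show "AE x in lborel. (x \<in> {c..b}) = (x \<in> {c<..b})"
      using AE_lborel_singleton[of c] by eventually_elim auto
  qed
  ultimately show ?thesis by simp
qed

lemma continuous_imp_set_integrable_Icc: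
  fixes f :: "real \<Rightarrow> real"
  assumes "continuous_on {a..b} f" "a \<le> s" "t \<le> b"
  shows "set_integrable lborel {s..t} f"
  by (rule borel_integrable_atLeastAtMost', rule continuous_on_subset[OF assms(1)]) (use assms in auto)

text \<open>After the last time before \<open>t\<close> at which \<open>d\<close> is nonpositive,
  \<open>d\<close> stays positive, so its integral is nonnegative and \<open>\<kappa>\<close>,
  whatever its sign, may be replaced by \<open>\<bar>\<kappa>\<bar> + 1\<close>. On a short enough
  interval the maximum of \<open>d\<close> would then be at most half of itself.\<close>

lemma gronwall_nonpos:
  fixes d :: "real \<Rightarrow> real"
  assumes cont: "continuous_on {0..b} d"
    and step: "\<And>s t. 0 \<le> s \<Longrightarrow> s \<le> t \<Longrightarrow> t \<le> b \<Longrightarrow> d t - d s \<le> \<kappa> * (LBINT x:{s..t}. d x)"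
    and init: "d 0 \<le> 0" and t: "0 \<le> t" "t \<le> b"
  shows "d t \<le> 0"
proof (rule ccontr)
  assume "\<not> d t \<le> 0"
  then have dt: "0 < d t" by simp
  define A where "A = {0..t} \<inter> d -` {..0}"
  have "closed A" unfolding A_def
    by (rule continuous_closed_preimage[OF continuous_on_subset[OF cont]]) (use t in auto)
  then have "compact A" using compact_Int_closed[of "{0..t}" A] by (auto simp: A_def Int_absorb1)
  moreover have "A \<noteq> {}" using init t by (auto simp: A_def)
  ultimately obtain \<sigma> where \<sigma>: "\<sigma> \<in> A" "\<And>x. x \<in> A \<Longrightarrow> x \<le> \<sigma>"
    using compact_attains_sup[of A] by auto
  have s: "0 \<le> \<sigma>" "\<sigma> < t" "d \<sigma> \<le> 0" using \<sigma>(1) dt unfolding A_def by (auto simp: less_le)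
  have pos: "0 < d x" if "\<sigma> < x" "x \<le> t" for x
    using \<sigma>(2)[of x] that s by (force simp: A_def)
  \<comment> \<open>This length makes the factor
    \<open>(\<bar>\<kappa>\<bar> + 1) * (p - \<sigma>)\<close> below at most 1/2.\<close>
  define e where "e = min t (\<sigma> + 1 / (2 * (\<bar>\<kappa>\<bar> + 1)))"
  have e: "\<sigma> < e" "e \<le> t" using s by (auto simp: e_def)
  have ce: "continuous_on {\<sigma>..e} d" by (rule continuous_on_subset[OF cont]) (use s e t in auto)
  obtain p where p: "p \<in> {\<sigma>..e}" "\<And>x. x \<in> {\<sigma>..e} \<Longrightarrow> d x \<le> d p"
    using continuous_attains_sup[OF _ _ ce] e by auto
  have dp: "0 < d p" using pos[of e] p(2)[of e] e by auto
  then have "\<sigma> < p" using p s by (cases "p = \<sigma>") auto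
  have int: "set_integrable lborel {\<sigma>..p} d"
    by (rule continuous_imp_set_integrable_Icc[OF ce]) (use p in auto)
  have ub: "(LBINT x:{\<sigma>..p}. d x) \<le> (p - \<sigma>) * d p"
  proof -
    have "(LBINT x:{\<sigma>..p}. d x) \<le> (LBINT x:{\<sigma>..p}. d p)"
      by (rule set_integral_mono[OF int]) (use p in \<open>auto simp: set_integrable_def\<close>)
    then show ?thesis using \<open>\<sigma> < p\<close> by (simp add: set_integral_const)
  qed
  have lb: "0 \<le> (LBINT x:{\<sigma>..p}. d x)"
  proof -
    have "AE x in lborel. x \<in> {\<sigma>..p} \<longrightarrow> 0 \<le> d x"
      using AE_lborel_singleton[of \<sigma>]
      by eventually_elim (use pos e p in \<open>auto simp: less_le\<close>)
    then show ?thesis unfolding set_lebesgue_integral_def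
      by (intro integral_nonneg_AE) (auto simp: indicator_def elim!: eventually_mono)
  qed
  have "d p \<le> d p - d \<sigma>" using s by simp
  also have "\<dots> \<le> \<kappa> * (LBINT x:{\<sigma>..p}. d x)" by (rule step) (use s p e t in auto)
  also have "\<dots> \<le> (\<bar>\<kappa>\<bar> + 1) * ((p - \<sigma>) * d p)"
    using lb ub by (intro mult_mono) auto
  also have "\<dots> = ((\<bar>\<kappa>\<bar> + 1) * (p - \<sigma>)) * d p" by simp
  also have "\<dots> \<le> (1/2) * d p"
  proof (rule mult_right_mono)
    have "p - \<sigma> \<le> 1 / (2 * (\<bar>\<kappa>\<bar> + 1))" using p(1) by (auto simp: e_def)
    then have "(\<bar>\<kappa>\<bar> + 1) * (p - \<sigma>) \<le> (\<bar>\<kappa>\<bar> + 1) * (1 / (2 * (\<bar>\<kappa>\<bar> + 1)))"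
      by (intro mult_left_mono) auto
    also have "\<dots> = 1/2"
      using abs_ge_zero[of \<kappa>] by (simp only: times_divide_eq_right mult_1_right nonzero_divide_mult_cancel_right)
    finally show "(\<bar>\<kappa>\<bar> + 1) * (p - \<sigma>) \<le> 1/2" .
  qed (use dp in simp)
  finally show False using dp by simp
qed

lemma continuous_on_primitive_right:
  fixes g :: "real \<Rightarrow> real"
  assumes g: "set_integrable lborel {a..b} g"
  shows "continuous_on {a..b} (\<lambda>s. LBINT x:{s..b}. g x)"
proof -
  have *: "g integrable_on {a..b}" using set_borel_integral_eq_integral(1)[OF g] .
  have "continuous_on {a..b} (\<lambda>s. integral {s..b} g)"
    by (rule indefinite_integral_continuous_1'[OF *])
  moreover have "(LBINT x:{s..b}. g x) = integral {s..b} g" if "s \<in> {a..b}" for s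
    by (rule set_borel_integral_eq_integral(2)[OF set_integrable_subset[OF g]]) (use that in auto)
  ultimately show ?thesis by (auto intro: continuous_on_eq)
qed

lemma continuous_on_primitive:
  fixes g :: "real \<Rightarrow> real"
  assumes g: "set_integrable lborel {a..b} g"
  shows "continuous_on {a..b} (\<lambda>s. LBINT x:{a..s}. g x)"
proof -
  have *: "g integrable_on {a..b}" using set_borel_integral_eq_integral(1)[OF g] .
  have "continuous_on {a..b} (\<lambda>s. integral {a..s} g)"
    by (rule indefinite_integral_continuous_1[OF *])
  moreover have "(LBINT x:{a..s}. g x) = integral {a..s} g" if "s \<in> {a..b}" for s
    by (rule set_borel_integral_eq_integral(2)[OF set_integrable_subset[OF g]]) (use that in auto)
  ultimately show ?thesis by (auto intro: continuous_on_eq)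
qed

lemma set_integral_nonpos_AE:
  fixes g :: "real \<Rightarrow> real"
  assumes "AE x in M. x \<in> A \<longrightarrow> g x \<le> 0"
  shows "(LINT x:A|M. g x) \<le> 0"
proof -
  have "0 \<le> (\<integral>x. - (indicator A x *\<^sub>R g x) \<partial>M)"
    by (rule integral_nonneg_AE) (use assms in \<open>auto simp: indicator_def elim!: eventually_mono\<close>)
  then show ?thesis by (simp add: set_lebesgue_integral_def)
qed

text \<open>The function \<open>c\<close> minus the integral of \<open>g\<close> over [s, m], called
  \<open>Y\<close> in the proof, satisfies Y' = k Y almost everywhere and equals \<open>c\<close> at
  the right end. To the left of the smallest point \<open>\<sigma>\<close> with Y \<ge> 0 it is
  negative, so g = k Y \<le> 0 there and Y 0 \<ge> Y \<sigma> \<ge> 0. This sign argument copes with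
  an unbounded factor \<open>k\<close>, as \<open>\<zeta>\<close> along a characteristic may
  be.\<close>

lemma volterra_nonneg:
  fixes g k :: "real \<Rightarrow> real"
  assumes g: "set_integrable lborel {0..m} g" and "0 \<le> m" "0 \<le> c" "\<And>s. 0 \<le> k s"
    and eq: "AE s in lborel. s \<in> {0<..<m} \<longrightarrow> g s = k s * (c - (LBINT x:{s..m}. g x))"
  shows "0 \<le> c - (LBINT x:{0..m}. g x)"
proof (rule ccontr)
  define Y where "Y = (\<lambda>s. c - (LBINT x:{s..m}. g x))"
  assume "\<not> 0 \<le> c - (LBINT x:{0..m}. g x)"
  then have Y0: "Y 0 < 0" by (simp add: Y_def)
  have cont: "continuous_on {0..m} Y" unfolding Y_def
    by (intro continuous_intros continuous_on_primitive_right g)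
  have "(LBINT x:{m..m}. g x) = 0"
    unfolding set_lebesgue_integral_def
    by (rule integral_eq_zero_AE) (use AE_lborel_singleton[of m] in \<open>auto elim!: eventually_mono\<close>)
  then have Ym: "0 \<le> Y m" using assms by (simp add: Y_def)
  define A where "A = {0..m} \<inter> Y -` {0..}"
  have "closed A" unfolding A_def by (rule continuous_closed_preimage[OF cont]) auto
  then have "compact A" using compact_Int_closed[of "{0..m}" A] by (auto simp: A_def Int_absorb1)
  moreover have "A \<noteq> {}" using Ym assms by (auto simp: A_def)
  ultimately obtain \<sigma> where \<sigma>: "\<sigma> \<in> A" "\<And>x. x \<in> A \<Longrightarrow> \<sigma> \<le> x"
    using compact_attains_inf[of A] by auto
  have s: "0 \<le> \<sigma>" "\<sigma> \<le> m" "0 \<le> Y \<sigma>" using \<sigma>(1) by (auto simp: A_def)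
  have neg: "Y x < 0" if "0 \<le> x" "x < \<sigma>" for x
    using \<sigma>(2)[of x] that s by (force simp: A_def)
  have "AE x in lborel. x \<in> {0..\<sigma>} \<longrightarrow> g x \<le> 0"
    using eq AE_lborel_singleton[of 0] AE_lborel_singleton[of \<sigma>]
  proof eventually_elim
    case (elim x)
    show ?case
    proof
      assume "x \<in> {0..\<sigma>}"
      then have x: "0 < x" "x < \<sigma>" using elim by auto
      then have "g x = k x * Y x" using elim s by (auto simp: Y_def)
      then show "g x \<le> 0" using neg[of x] x assms(4)[of x] by (simp add: mult_nonneg_nonpos)
    qed
  qed
  then have "(LBINT x:{0..\<sigma>}. g x) \<le> 0" by (rule set_integral_nonpos_AE)
  moreover have "Y 0 = Y \<sigma> - (LBINT x:{0..\<sigma>}. g x)"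
    unfolding Y_def using set_integral_Icc_split[OF g s(1,2)] by simp
  ultimately show False using Y0 s by simp
qed

section \<open>Measurability and null sets along characteristics\<close>

lemma measurable_characteristics:
  fixes t \<epsilon> :: real
  shows "(\<lambda>x. (t - \<epsilon> * fst x, snd x - fst x)) \<in> borel \<Otimes>\<^sub>M borel \<rightarrow>\<^sub>M borel \<Otimes>\<^sub>M borel"
  by (intro measurable_Pair) auto

lemma sets_lborel_pair: "sets (lborel \<Otimes>\<^sub>M lborel) = sets (borel \<Otimes>\<^sub>M borel)"
  by (intro sets_pair_measure_cong) auto

lemma measurable_lborel_pair: "measurable (lborel \<Otimes>\<^sub>M lborel) N = measurable (borel \<Otimes>\<^sub>M borel) N"
  by (intro measurable_cong_sets sets_lborel_pair refl)

text \<open>For fixed \<open>s\<close> the translation from \<open>a\<close> to \<open>a - s\<close>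
  preserves null sets, so the property holds for almost every \<open>a\<close>; joint measurability
  then lets Fubini exchange the two quantifiers. The strict bounds on \<open>s\<close> keep the time
  in (0, t) and the age positive.\<close>

lemma AE_characteristics:
  fixes P :: "real \<Rightarrow> real \<Rightarrow> bool"
  assumes meas: "Measurable.pred (borel \<Otimes>\<^sub>M borel) (\<lambda>x. P (fst x) (snd x))"
    and P: "\<And>\<tau>. 0 < \<tau> \<Longrightarrow> \<tau> < t \<Longrightarrow> AE b in lborel. 0 < b \<longrightarrow> P \<tau> b" and "0 < \<epsilon>"
  shows "AE a in lborel. AE s in lborel. 0 < s \<and> s < min a (t / \<epsilon>) \<longrightarrow> P (t - \<epsilon> * s) (a - s)"
proof -
  have "AE s in lborel. AE a in lborel. 0 < s \<and> s < min a (t / \<epsilon>) \<longrightarrow> P (t - \<epsilon> * s) (a - s)"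
  proof (rule AE_I2)
    fix s :: real
    show "AE a in lborel. 0 < s \<and> s < min a (t / \<epsilon>) \<longrightarrow> P (t - \<epsilon> * s) (a - s)"
    proof (cases "0 < s \<and> s < t / \<epsilon>")
      case True
      then have "0 < t - \<epsilon> * s" "t - \<epsilon> * s < t" using \<open>0 < \<epsilon>\<close> by (auto simp: field_simps)
      from P[OF this] have *: "AE b in lborel. 0 < b \<longrightarrow> P (t - \<epsilon> * s) b" .
      have [measurable]: "Measurable.pred borel (P (t - \<epsilon> * s))"
        using measurable_compose[OF _ meas, of "\<lambda>b. (t - \<epsilon> * s, b)" borel] by simp
      have "AE a in lborel. 0 < -s + 1 * a \<longrightarrow> P (t - \<epsilon> * s) (-s + 1 * a)"
        by (rule AE_borel_affine[OF _ _ *]) auto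
      then show ?thesis by eventually_elim auto
    qed auto
  qed
  moreover have "Measurable.pred (borel \<Otimes>\<^sub>M borel) (\<lambda>x. P (t - \<epsilon> * fst x) (snd x - fst x))"
    using measurable_compose[OF measurable_characteristics meas, of t \<epsilon>] by simp
  then have "Measurable.pred (borel \<Otimes>\<^sub>M borel)
      (\<lambda>x. 0 < fst x \<and> fst x < min (snd x) (t / \<epsilon>) \<longrightarrow> P (t - \<epsilon> * fst x) (snd x - fst x))"
    by measurable
  then have "{x \<in> space (lborel \<Otimes>\<^sub>M lborel). 0 < fst x \<and> fst x < min (snd x) (t / \<epsilon>) \<longrightarrow>
      P (t - \<epsilon> * fst x) (snd x - fst x)} \<in> sets (lborel \<Otimes>\<^sub>M lborel)"
    by (simp add: sets_lborel_pair pred_def space_pair_measure)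
  ultimately show ?thesis
    using lborel_pair.AE_commute[of "\<lambda>s a. 0 < s \<and> s < min a (t / \<epsilon>) \<longrightarrow> P (t - \<epsilon> * s) (a - s)"]
    by blast
qed

section \<open>Calculus: primitives, convex tangents and essential infima\<close>

text \<open>\<open>deriv f\<close> itself need not be visibly Borel measurable, hence the representative \<open>d\<close>.\<close>

lemma lipschitz_FTC:
  fixes f :: "real \<Rightarrow> real"
  assumes lip: "L-lipschitz_on {0..t} f" and "0 < t"
    and diff: "AE x in lborel. x \<in> {0<..<t} \<longrightarrow> f differentiable (at x)"
  obtains d where "set_integrable lborel {0..t} d"
    and "AE x in lborel. x \<in> {0<..<t} \<longrightarrow> d x = deriv f x"
    and "(LBINT x:{0..t}. d x) = f t - f 0"
proof -
  \<comment> \<open>Constant continuation outside [0, t] makes the difference quotients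
    \<open>q n\<close> meaningful on the whole line, with the same Lipschitz bound
    \<open>L\<close>.\<close>
  define g where "g = (\<lambda>x. f (max 0 (min t x)))"
  define h where "h = (\<lambda>n::nat. 1 / real (Suc n))"
  define q where "q = (\<lambda>n x. (g (x + h n) - g x) / h n)"
  have h: "0 < h n" for n by (simp add: h_def)
  have h0: "h \<longlonglongrightarrow> 0" unfolding h_def by (rule LIMSEQ_Suc[OF lim_const_over_n])
  have glip: "\<bar>g x - g y\<bar> \<le> L * \<bar>x - y\<bar>" for x y
  proof -
    have "\<bar>g x - g y\<bar> \<le> L * \<bar>max 0 (min t x) - max 0 (min t y)\<bar>"
      using lipschitz_onD[OF lip, of "max 0 (min t x)" "max 0 (min t y)"] \<open>0 < t\<close>
      by (auto simp: g_def dist_real_def)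
    also have "\<dots> \<le> L * \<bar>x - y\<bar>"
      using lipschitz_on_nonneg[OF lip] by (intro mult_left_mono) auto
    finally show ?thesis .
  qed
  have gcont: "continuous_on UNIV g"
  proof -
    have "L-lipschitz_on UNIV g"
      using glip lipschitz_on_nonneg[OF lip] by (auto simp: lipschitz_on_def dist_real_def)
    then show ?thesis by (rule lipschitz_on_continuous_on)
  qed
  \<comment> \<open>With an antiderivative of \<open>g\<close> the integral of \<open>q n\<close> is
    exactly a difference of two difference quotients of \<open>G\<close>, which converge to
    \<open>g t\<close> and \<open>g 0\<close>.\<close>
  obtain G where G: "\<And>x. (G has_vector_derivative g x) (at x)"
    using einterval_antiderivative[of "-\<infinity>" \<infinity> g] gcont
    by (auto simp: continuous_on_eq_continuous_at)
  have G': "(G has_real_derivative g x) (at x)" for x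
    using G by (simp add: has_real_derivative_iff_has_vector_derivative)
  have qcont: "continuous_on S (q n)" for S n
    unfolding q_def using h[of n]
    by (intro continuous_intros continuous_on_subset[OF gcont]
        continuous_on_compose2[OF gcont]) auto
  have [measurable]: "q n \<in> borel_measurable borel" for n
    by (rule borel_measurable_continuous_onI[OF qcont])
  have int_q: "(LBINT x:{0..t}. q n x) = (G (t + h n) - G t) / h n - (G (0 + h n) - G 0) / h n" for n
  proof -
    have "((\<lambda>x. (G (x + h n) - G x) / h n) has_vector_derivative q n x) (at x within {0..t})" for x
    proof -
      have "((\<lambda>x. (G (x + h n) - G x) / h n) has_real_derivative q n x) (at x)"
        unfolding q_def using h[of n]
        by (auto intro!: derivative_eq_intros DERIV_chain2[OF G'])
      then show ?thesis
        by (simp add: has_real_derivative_iff_has_vector_derivative has_vector_derivative_at_within)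
    qed
    from integral_FTC_atLeastAtMost[OF _ this qcont] \<open>0 < t\<close>
    have "(LBINT x:{0..t}. q n x) = (G (t + h n) - G t) / h n - (G (0 + h n) - G 0) / h n"
      by (simp add: set_lebesgue_integral_def)
    then show ?thesis .
  qed
  have lim_G: "(\<lambda>n. (G (x + h n) - G x) / h n) \<longlonglongrightarrow> g x" for x
  proof -
    have "((\<lambda>k. (G (x + k) - G x) / k) \<longlongrightarrow> g x) (at 0)" using G'[of x] by (simp add: DERIV_def)
    moreover have "filterlim h (at 0) sequentially"
      using h0 h by (auto simp: filterlim_at less_imp_neq[symmetric])
    ultimately show ?thesis by (rule filterlim_compose)
  qed
  have lim: "(\<lambda>n. LBINT x:{0..t}. q n x) \<longlonglongrightarrow> g t - g 0"
    unfolding int_q by (intro tendsto_intros lim_G)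
  have qb: "\<bar>q n x\<bar> \<le> L" for n x
    using glip[of "x + h n" x] h[of n] by (simp add: q_def field_simps)
  have q_lim: "AE x in lborel. (\<lambda>n. indicator {0<..<t} x *\<^sub>R q n x) \<longlonglongrightarrow> indicator {0<..<t} x *\<^sub>R deriv f x"
    using diff
  proof eventually_elim
    case (elim x)
    show ?case
    proof (cases "x \<in> {0<..<t}")
      case True
      then have "(f has_real_derivative deriv f x) (at x)"
        using elim by (simp add: DERIV_deriv_iff_real_differentiable)
      then have "(g has_real_derivative deriv f x) (at x)"
        by (rule has_field_derivative_transform_within_open[where S = "{0<..<t}"])
          (use True in \<open>auto simp: g_def\<close>)
      then have "((\<lambda>k. (g (x + k) - g x) / k) \<longlongrightarrow> deriv f x) (at 0)" by (simp add: DERIV_def)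
      moreover have "filterlim h (at 0) sequentially"
        using h0 h by (auto simp: filterlim_at less_imp_neq[symmetric])
      ultimately have "(\<lambda>n. q n x) \<longlonglongrightarrow> deriv f x"
        unfolding q_def by (rule filterlim_compose)
      then show ?thesis using True by simp
    qed simp
  qed
  \<comment> \<open>The \<open>lim\<close> of a sequence of Borel functions is Borel, whatever value
    it takes where the sequence diverges. The uniform bound \<open>L\<close> on the quotients
    provides the dominating function.\<close>
  define d where "d = (\<lambda>x. lim (\<lambda>n. indicator {0<..<t} x *\<^sub>R q n x))"
  have [measurable]: "d \<in> borel_measurable borel" unfolding d_def by measurable
  have d: "AE x in lborel. (\<lambda>n. indicator {0<..<t} x *\<^sub>R q n x) \<longlonglongrightarrow> d x"
    using q_lim by eventually_elim (simp add: d_def limI)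
  have bound: "AE x in lborel. norm (indicator {0<..<t} x *\<^sub>R q n x) \<le> L * indicator {0<..<t} x" for n
    using qb[of n] by (auto simp: indicator_def)
  have dom: "integrable lborel (\<lambda>x. L * indicator {0<..<t} x)"
    using \<open>0 < t\<close> by (intro integrable_mult_right integrable_real_indicator) auto
  have d_int: "integrable lborel d"
    by (rule integrable_dominated_convergence[OF _ _ dom d bound]) auto
  have "(\<lambda>n. LBINT x:{0<..<t}. q n x) \<longlonglongrightarrow> (LBINT x. d x)"
    unfolding set_lebesgue_integral_def
    by (rule integral_dominated_convergence[OF _ _ dom d bound]) auto
  moreover have "(LBINT x:{0<..<t}. q n x) = (LBINT x:{0..t}. q n x)" for n
  proof (rule set_integral_cong_set)
    show "AE x in lborel. (x \<in> {0..t}) = (x \<in> {0<..<t})"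
      using AE_lborel_singleton[of 0] AE_lborel_singleton[of t] by eventually_elim auto
  qed (auto simp: set_borel_measurable_def)
  ultimately have d_val: "(LBINT x. d x) = f t - f 0"
    using LIMSEQ_unique[OF lim] \<open>0 < t\<close> by (simp add: g_def)
  have d_eq: "AE x in lborel. d x = indicator {0<..<t} x *\<^sub>R deriv f x"
    using d q_lim by eventually_elim (rule LIMSEQ_unique)
  have d_ind: "AE x in lborel. indicator {0..t} x *\<^sub>R d x = d x"
    using d_eq by eventually_elim (auto simp: indicator_def)
  show ?thesis
  proof (rule that[of d])
    show "set_integrable lborel {0..t} d"
      unfolding set_integrable_def using integrable_cong_AE[THEN iffD2, OF _ _ d_ind d_int] by simp
    show "AE x in lborel. x \<in> {0<..<t} \<longrightarrow> d x = deriv f x"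
      using d_eq by eventually_elim auto
    show "(LBINT x:{0..t}. d x) = f t - f 0"
      unfolding set_lebesgue_integral_def d_val[symmetric] by (rule integral_cong_AE[OF _ _ d_ind]) auto
  qed
qed

text \<open>Integration by parts for primitives of integrable functions: the product of the two
  integrals is an integral over a square, which Fubini treats separately on both sides of the
  diagonal. The diagonal is assigned to one triangle only, so the integrand splits pointwise; the
  resulting half-open inner range differs from the closed one by a null set.\<close>

lemma primitive_mult:
  fixes p g :: "real \<Rightarrow> real"
  assumes p: "set_integrable lborel {0..t} p" and g: "set_integrable lborel {0..t} g"
  shows "set_integrable lborel {0..t} (\<lambda>x. p x * (LBINT y:{0..x}. g y))" (is ?I1)
    and "set_integrable lborel {0..t} (\<lambda>x. g x * (LBINT y:{0..x}. p y))" (is ?I2)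
    and "(LBINT x:{0..t}. p x) * (LBINT x:{0..t}. g x) =
      (LBINT x:{0..t}. p x * (LBINT y:{0..x}. g y)) + (LBINT x:{0..t}. g x * (LBINT y:{0..x}. p y))" (is ?E)
proof -
  define p' where "p' = (\<lambda>x. indicator {0..t} x * p x)"
  define g' where "g' = (\<lambda>x. indicator {0..t} x * g x)"
  have p': "integrable lborel p'" and g': "integrable lborel g'"
    using p g by (auto simp: p'_def g'_def set_integrable_def)
  have m [measurable]: "p' \<in> borel_measurable borel" "g' \<in> borel_measurable borel"
    using p' g' by (auto dest: borel_measurable_integrable)
  have int: "integrable (lborel \<Otimes>\<^sub>M lborel) (\<lambda>(x, y). p' x * g' y)"
  proof (rule lborel_pair.Fubini_integrable)
    show "(\<lambda>(x, y). p' x * g' y) \<in> borel_measurable (lborel \<Otimes>\<^sub>M lborel)"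
      by measurable
    show "integrable lborel (\<lambda>x. LBINT y. norm (case (x, y) of (x, y) \<Rightarrow> p' x * g' y))"
      using integrable_norm[OF p'] by (simp add: abs_mult)
    show "AE x in lborel. integrable lborel (\<lambda>y. case (x, y) of (x, y) \<Rightarrow> p' x * g' y)"
      using g' by simp
  qed
  have lo: "integrable (lborel \<Otimes>\<^sub>M lborel) (\<lambda>(x, y). p' x * (indicator {..x} y * g' y))"
    by (rule Bochner_Integration.integrable_bound[OF int])
      (auto simp: split_beta' abs_mult indicator_def)
  have hi: "integrable (lborel \<Otimes>\<^sub>M lborel) (\<lambda>(x, y). g' y * (indicator {..<y} x * p' x))"
    by (rule Bochner_Integration.integrable_bound[OF int])
      (auto simp: split_beta' abs_mult indicator_def)
  have in1: "(LBINT y. indicator {..x} y * g' y) = (LBINT y:{0..x}. g y)" if "x \<in> {0..t}" for x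
    unfolding set_lebesgue_integral_def
    by (rule Bochner_Integration.integral_cong) (use that in \<open>auto simp: g'_def indicator_def\<close>)
  have in2: "(LBINT y. indicator {..<x} y * p' y) = (LBINT y:{0..x}. p y)" if "x \<in> {0..t}" for x
  proof -
    have "(LBINT y. indicator {..<x} y * p' y) = (LBINT y. indicator {..x} y * p' y)"
      by (rule integral_cong_AE) (use AE_lborel_singleton[of x] in \<open>auto simp: indicator_def elim!: eventually_mono\<close>)
    also have "\<dots> = (LBINT y:{0..x}. p y)"
      unfolding set_lebesgue_integral_def
      by (rule Bochner_Integration.integral_cong) (use that in \<open>auto simp: p'_def indicator_def\<close>)
    finally show ?thesis .
  qed
  have e1: "(LBINT y. p' x * (indicator {..x} y * g' y)) =
      indicator {0..t} x *\<^sub>R (p x * (LBINT y:{0..x}. g y))" for x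
    using in1[of x] by (auto simp: p'_def indicator_def)
  have e2: "(LBINT x. g' y * (indicator {..<y} x * p' x)) =
      indicator {0..t} y *\<^sub>R (g y * (LBINT x:{0..y}. p x))" for y
    using in2[of y] by (auto simp: g'_def indicator_def)
  show ?I1 using lborel_pair.integrable_fst[OF lo] unfolding set_integrable_def e1 .
  show ?I2 using lborel_pair.integrable_snd[OF hi] unfolding set_integrable_def e2 .
  have "(LBINT x:{0..t}. p x) * (LBINT x:{0..t}. g x) = (LBINT x. LBINT y. p' x * g' y)"
    by (simp add: p'_def g'_def set_lebesgue_integral_def)
  also have "\<dots> = integral\<^sup>L (lborel \<Otimes>\<^sub>M lborel) (\<lambda>(x, y). p' x * g' y)"
    by (rule lborel_pair.integral_fst[OF int])
  also have "(\<lambda>(x, y). p' x * g' y) = (\<lambda>z. (case z of (x, y) \<Rightarrow> p' x * (indicator {..x} y * g' y))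
      + (case z of (x, y) \<Rightarrow> g' y * (indicator {..<y} x * p' x)))"
    by (auto simp: indicator_def fun_eq_iff)
  also have "integral\<^sup>L (lborel \<Otimes>\<^sub>M lborel) \<dots> =
      integral\<^sup>L (lborel \<Otimes>\<^sub>M lborel) (\<lambda>(x, y). p' x * (indicator {..x} y * g' y))
      + integral\<^sup>L (lborel \<Otimes>\<^sub>M lborel) (\<lambda>(x, y). g' y * (indicator {..<y} x * p' x))"
    by (rule Bochner_Integration.integral_add[OF lo hi])
  also have "\<dots> = (LBINT x. LBINT y. p' x * (indicator {..x} y * g' y))
      + (LBINT y. LBINT x. g' y * (indicator {..<y} x * p' x))"
    using lborel_pair.integral_fst[OF lo] lborel_pair.integral_snd[OF hi] by simp
  finally show ?E unfolding e1 e2 set_lebesgue_integral_def .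
qed

text \<open>By convexity the chord from 0 to a point \<open>x\<close> below \<open>u\<close> has at
  most the slope of the chord to \<open>u\<close>; letting \<open>x\<close> tend to 0 bounds
  \<open>D\<close>.\<close>

lemma convex_on_tangent_at_0:
  fixes h :: "real \<Rightarrow> real"
  assumes conv: "convex_on {0..} h" and der: "(h has_real_derivative D) (at_right 0)" and "0 \<le> u"
  shows "h 0 + D * u \<le> h u"
proof (cases "u = 0")
  case False
  then have u: "0 < u" using assms by simp
  have lim: "((\<lambda>x. (h x - h 0) / (x - 0)) \<longlongrightarrow> D) (at_right 0)"
    using der by (simp add: has_field_derivative_iff)
  have "eventually (\<lambda>x. (h x - h 0) / (x - 0) \<le> (h u - h 0) / u) (at_right 0)"
    using eventually_at_right_real[OF u]
  proof eventually_elim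
    case (elim x)
    then have x: "0 < x" "x < u" by auto
    have "h ((1 - x / u) *\<^sub>R 0 + (x / u) *\<^sub>R u) \<le> (1 - x / u) * h 0 + (x / u) * h u"
      by (rule convex_onD[OF conv]) (use x u in auto)
    then have "h x - h 0 \<le> x * ((h u - h 0) / u)"
      using u by (simp add: algebra_simps diff_divide_distrib)
    then show ?case using x by (simp add: field_simps)
  qed
  then have "D \<le> (h u - h 0) / u"
    by (rule tendsto_upperbound[OF lim]) simp
  then show ?thesis using u by (simp add: field_simps)
qed simp

text \<open>The supremum in \<open>ess_inf_on\<close> is genuine: the set of essential lower bounds
  contains \<open>c\<close>, and it is bounded above because otherwise \<open>g\<close> would exceed
  every natural number almost everywhere on the non-null set \<open>S\<close>. Approaching the
  supremum by the countable sequence with gaps 1/(n+1) then costs only one null set.\<close>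

lemma ess_inf_on_le_AE:
  assumes S: "S \<in> sets lborel" "emeasure lborel S \<noteq> 0" and lb: "AE t in lborel. t \<in> S \<longrightarrow> c \<le> g t"
  shows "AE t in lborel. t \<in> S \<longrightarrow> ess_inf_on S g \<le> g t"
proof -
  define C where "C = {c. AE t in lborel. t \<in> S \<longrightarrow> c \<le> g t}"
  have "c \<in> C" using lb by (simp add: C_def)
  have below: "AE t in lborel. t \<in> S \<longrightarrow> b \<le> g t" if "a \<in> C" "b < a" for a b
    using that unfolding C_def by (auto elim!: eventually_mono)
  have bdd: "bdd_above C"
  proof (rule ccontr)
    assume "\<not> bdd_above C"
    then have "\<exists>x\<in>C. real n < x" for n by (auto simp: bdd_above_def not_le)
    then have "\<forall>n::nat. AE t in lborel. t \<in> S \<longrightarrow> real n \<le> g t"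
      using below by blast
    then have "AE t in lborel. \<forall>n::nat. t \<in> S \<longrightarrow> real n \<le> g t" by (unfold AE_all_countable)
    then have "AE t in lborel. t \<notin> S"
      by eventually_elim (meson linorder_not_le reals_Archimedean2)
    then show False using S AE_iff_measurable[OF S(1), of "\<lambda>t. t \<notin> S"] by auto
  qed
  have "\<exists>c\<in>C. Sup C - 1 / real (Suc n) < c" for n
    using less_cSup_iff[OF _ bdd, of "Sup C - 1 / real (Suc n)"] \<open>c \<in> C\<close> by auto
  then have "\<forall>n. AE t in lborel. t \<in> S \<longrightarrow> Sup C - 1 / real (Suc n) \<le> g t"
    using below by blast
  then have "AE t in lborel. \<forall>n. t \<in> S \<longrightarrow> Sup C - 1 / real (Suc n) \<le> g t"
    by (unfold AE_all_countable)
  then have "AE t in lborel. t \<in> S \<longrightarrow> Sup C \<le> g t"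
  proof eventually_elim
    case (elim t)
    show ?case
    proof
      assume "t \<in> S"
      have "(\<lambda>n. Sup C - 1 / real (Suc n)) \<longlonglongrightarrow> Sup C - 0"
        by (intro tendsto_intros LIMSEQ_Suc[OF lim_const_over_n])
      then have "Sup C - 0 \<le> g t"
        by (rule LIMSEQ_le_const2) (use elim \<open>t \<in> S\<close> in auto)
      then show "Sup C \<le> g t" by simp
    qed
  qed
  then show ?thesis by (simp add: ess_inf_on_def C_def)
qed

text \<open>This provides the lower bound that \<open>ess_inf_on_le_AE\<close> asks for on all of
  (0, \<open>t0\<close>), an interval that may reach beyond \<open>T\<close>, where no sign of the
  derivative is assumed.\<close>

lemma deriv_lower_bound_of_lipschitz:
  fixes f :: "real \<Rightarrow> real"
  assumes lip: "L-lipschitz_on {0..S} f"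
  obtains c where "\<And>t. t \<in> {0<..<S} \<Longrightarrow> c \<le> deriv f t"
proof
  \<comment> \<open>Where \<open>f\<close> is not differentiable, \<open>deriv f\<close> takes one and the same junk value.\<close>
  fix t assume t: "t \<in> {0<..<S}"
  show "min (- L) (SOME D::real. False) \<le> deriv f t"
  proof (cases "f differentiable (at t)")
    case True
    then have "(f has_real_derivative deriv f t) (at t)"
      by (simp add: DERIV_deriv_iff_real_differentiable)
    then have lim: "((\<lambda>x. (f x - f t) / (x - t)) \<longlongrightarrow> deriv f t) (at t)"
      by (simp add: has_field_derivative_iff)
    have "eventually (\<lambda>x. - L \<le> (f x - f t) / (x - t)) (at t)"
      using eventually_at_in_open[of "{0<..<S}" t] t
    proof (auto elim!: eventually_mono)
      fix x assume x: "0 < x" "x < S" "x \<noteq> t"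
      have "\<bar>f x - f t\<bar> \<le> L * \<bar>x - t\<bar>"
        using lipschitz_onD[OF lip, of x t] x t by (auto simp: dist_real_def)
      then have "\<bar>(f x - f t) / (x - t)\<bar> \<le> L" using x by (simp add: field_simps)
      then show "- L \<le> (f x - f t) / (x - t)" by linarith
    qed
    then have "- L \<le> deriv f t" by (rule tendsto_lowerbound[OF lim]) simp
    then show ?thesis by simp
  next
    case False
    then have "deriv f t = (SOME D. False)"
      by (simp add: deriv_def real_differentiable_def)
    then show ?thesis by simp
  qed
qed

subsection \<open>The age-structured density\<close>

locale age_system =
  fixes \<epsilon> :: real and \<zeta> \<beta> f \<rho>I vI :: "real \<Rightarrow> real" and T0 :: real
    and \<rho> v :: "real \<Rightarrow> real \<Rightarrow> real" and c :: "nat \<Rightarrow> real" and \<beta>min \<beta>max :: real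
  assumes eps: "0 < \<epsilon>"
    and sol: "char_solution \<epsilon> \<zeta> \<beta> f \<rho>I vI T0 \<rho> v"
    and A2: "assumption_A2 \<rho>I c"
    and A3: "assumption_A3 \<beta> \<beta>min \<beta>max"
    and zeta_nonneg: "\<And>u. 0 \<le> \<zeta> u"
    and zeta_cont: "continuous_on UNIV \<zeta>"
begin

text \<open>The extensions by zero are jointly measurable on the whole plane.\<close>

definition R :: "real \<Rightarrow> real \<Rightarrow> real" where
  "R t a = (if 0 < t \<and> t < T0 \<and> 0 \<le> a then \<rho> t a else 0)"

definition W :: "real \<Rightarrow> real \<Rightarrow> real" where
  "W t a = (if 0 < t \<and> t < T0 \<and> 0 \<le> a then v t a else 0)"

definition \<rho>I0 :: "real \<Rightarrow> real" where
  "\<rho>I0 a = (if 0 \<le> a then \<rho>I a else 0)"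

definition influx :: "real \<Rightarrow> real" where
  "influx \<tau> = (if 0 < \<tau> \<and> \<tau> < T0 then \<beta> \<tau> * (1 - \<mu>0 \<rho> \<tau>) else 0)"

definition death :: "real \<Rightarrow> real \<Rightarrow> real" where
  "death t a = \<zeta> (W t a) * R t a"

text \<open>The function that is constant along characteristics, with data \<open>B\<close> at age \<open>0\<close> and \<open>I\<close> at time \<open>0\<close>.\<close>

definition along :: "(real \<Rightarrow> real) \<Rightarrow> (real \<Rightarrow> real) \<Rightarrow> real \<Rightarrow> real \<Rightarrow> real" where
  "along B I t a = (if \<epsilon> * a < t then B (t - \<epsilon> * a) else I (a - t / \<epsilon>))"

lemma along_char:
  "s < min a (t / \<epsilon>) \<Longrightarrow> along B I (t - \<epsilon> * s) (a - s) = along B I t a"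
  unfolding along_def using eps by (auto simp: algebra_simps diff_divide_distrib)

lemma T0_pos: "0 < T0" using sol by (simp add: char_solution_def)

lemma R_meas: "(\<lambda>x. R (fst x) (snd x)) \<in> borel_measurable (borel \<Otimes>\<^sub>M borel)"
proof -
  have "(\<lambda>x. indicator ({0<..<T0} \<times> {0..}) x *\<^sub>R (case x of (t, a) \<Rightarrow> \<rho> t a)) \<in> borel_measurable borel"
    using sol by (simp add: char_solution_def continuous_L1_def set_borel_measurable_def)
  also have "(\<lambda>x. indicator ({0<..<T0} \<times> {0..}) x *\<^sub>R (case x of (t, a) \<Rightarrow> \<rho> t a)) =
      (\<lambda>x. R (fst x) (snd x))"
    by (auto simp: R_def indicator_def fun_eq_iff)
  finally show ?thesis by (simp add: borel_prod)
qed

lemma W_meas: "(\<lambda>x. W (fst x) (snd x)) \<in> borel_measurable (borel \<Otimes>\<^sub>M borel)"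
proof (rule borel_measurable_LIMSEQ_real)
  \<comment> \<open>The condition on \<open>v\<close> is available only up to times strictly below
    \<open>T0\<close>, so \<open>W\<close> is a limit of truncations at \<open>?T n\<close>, which
    increase to \<open>T0\<close>. The double successor makes the first one T0/2, which lies inside
    (0, T0).\<close>
  let ?T = "\<lambda>n. T0 - T0 / real (Suc (Suc n))"
  let ?W = "\<lambda>n x. indicator ({0<..<?T n} \<times> {0..}) x *\<^sub>R (case x of (t, a) \<Rightarrow> v t a)"
  show "?W n \<in> borel_measurable (borel \<Otimes>\<^sub>M borel)" for n
  proof -
    have "v \<in> space_X (?T n)"
    proof -
      have "?T n \<in> {0<..<T0}" using T0_pos by (simp add: field_simps add_pos_nonneg)
      then show ?thesis using sol unfolding char_solution_def by blast
    qed
    then show ?thesis by (simp add: space_X_def set_borel_measurable_def borel_prod)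
  qed
  fix x :: "real \<times> real"
  have lim: "?T \<longlonglongrightarrow> T0 - 0"
    by (intro tendsto_intros LIMSEQ_Suc[OF LIMSEQ_Suc[OF lim_const_over_n]])
  show "(\<lambda>n. ?W n x) \<longlonglongrightarrow> W (fst x) (snd x)"
  proof (cases "fst x < T0")
    case True
    have "eventually (\<lambda>n. fst x < ?T n) sequentially"
      using order_tendstoD(1)[OF lim, of "fst x"] True by simp
    then have "eventually (\<lambda>n. ?W n x = W (fst x) (snd x)) sequentially"
      by eventually_elim (use True in \<open>cases x; auto simp: W_def indicator_def\<close>)
    then show ?thesis by (rule tendsto_eventually)
  next
    case False
    have "?T n \<le> T0" for n using T0_pos by simp
    with False have "\<not> fst x < ?T n" for n by (smt (verit))
    then have "?W n x = W (fst x) (snd x)" for n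
      using False by (cases x) (auto simp: W_def indicator_def)
    then show ?thesis by simp
  qed
qed

lemma death_meas: "(\<lambda>x. death (fst x) (snd x)) \<in> borel_measurable (borel \<Otimes>\<^sub>M borel)"
proof -
  have [measurable]: "\<zeta> \<in> borel_measurable borel" by (rule borel_measurable_continuous_onI[OF zeta_cont])
  note [measurable] = R_meas W_meas
  show ?thesis unfolding death_def by measurable
qed

lemma death_meas' [measurable (raw)]:
  assumes "g \<in> borel_measurable M" "h \<in> borel_measurable M"
  shows "(\<lambda>x. death (g x) (h x)) \<in> borel_measurable M"
  using measurable_compose[OF measurable_Pair[OF assms] death_meas] by simp

lemma R_meas' [measurable (raw)]:
  assumes "g \<in> borel_measurable M" "h \<in> borel_measurable M"
  shows "(\<lambda>x. R (g x) (h x)) \<in> borel_measurable M"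
  using measurable_compose[OF measurable_Pair[OF assms] R_meas] by simp

lemma \<rho>I0_meas [measurable]: "\<rho>I0 \<in> borel_measurable borel"
proof -
  have "(\<lambda>a. indicator {0..} a *\<^sub>R \<rho>I a) \<in> borel_measurable borel"
    using A2 by (simp add: assumption_A2_def ess_bounded_def set_borel_measurable_def)
  also have "(\<lambda>a. indicator {0..} a *\<^sub>R \<rho>I a) = \<rho>I0" by (auto simp: \<rho>I0_def fun_eq_iff)
  finally show ?thesis .
qed

lemma \<rho>I0_nonneg: "AE a in lborel. 0 \<le> \<rho>I0 a"
  using A2 by (auto simp: assumption_A2_def \<rho>I0_def elim!: eventually_mono)

lemma \<rho>_integrable: "0 \<le> t \<Longrightarrow> t < T0 \<Longrightarrow> set_integrable lborel {0..} (\<rho> t)"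
  using sol by (simp add: char_solution_def continuous_L1_def)

lemma \<mu>0_cont: "continuous_on {0..<T0} (\<mu>0 \<rho>)"
  unfolding continuous_on_def
proof
  fix t assume t: "t \<in> {0..<T0}"
  have lim: "((\<lambda>s. LBINT a:{0..}. \<bar>\<rho> s a - \<rho> t a\<bar>) \<longlongrightarrow> 0) (at t within {0..<T0})"
    using sol t by (simp add: char_solution_def continuous_L1_def)
  have "((\<lambda>s. \<mu>0 \<rho> s - \<mu>0 \<rho> t) \<longlongrightarrow> 0) (at t within {0..<T0})"
  proof (rule Lim_null_comparison[OF _ lim])
    show "eventually (\<lambda>s. norm (\<mu>0 \<rho> s - \<mu>0 \<rho> t) \<le> (LBINT a:{0..}. \<bar>\<rho> s a - \<rho> t a\<bar>)) (at t within {0..<T0})"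
      unfolding eventually_at_filter
    proof (rule always_eventually, intro allI impI)
      fix s assume s: "s \<in> {0..<T0}"
      have i: "set_integrable lborel {0..} (\<rho> s)" "set_integrable lborel {0..} (\<rho> t)"
        using s t by (auto intro: \<rho>_integrable)
      have "\<mu>0 \<rho> s - \<mu>0 \<rho> t = (LBINT a:{0..}. \<rho> s a - \<rho> t a)"
        using i by (simp add: \<mu>0_def)
      also have "norm \<dots> \<le> (LBINT a. norm (indicator {0..} a *\<^sub>R (\<rho> s a - \<rho> t a)))"
        unfolding set_lebesgue_integral_def by (rule integral_norm_bound)
      also have "\<dots> = (LBINT a:{0..}. \<bar>\<rho> s a - \<rho> t a\<bar>)"
        unfolding set_lebesgue_integral_def by (auto intro!: Bochner_Integration.integral_cong simp: indicator_def)
      finally show "norm (\<mu>0 \<rho> s - \<mu>0 \<rho> t) \<le> (LBINT a:{0..}. \<bar>\<rho> s a - \<rho> t a\<bar>)" .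
    qed
  qed
  then show "(\<mu>0 \<rho> \<longlongrightarrow> \<mu>0 \<rho> t) (at t within {0..<T0})" by (simp add: LIM_zero_iff)
qed

lemma influx_meas [measurable]: "influx \<in> borel_measurable borel"
proof -
  have "continuous_on {0<..<T0} (\<lambda>\<tau>. \<beta> \<tau> * (1 - \<mu>0 \<rho> \<tau>))"
    using A3 by (intro continuous_intros continuous_on_subset[OF \<mu>0_cont])
      (auto simp: assumption_A3_def intro: continuous_on_subset)
  then have "(\<lambda>\<tau>. indicator {0<..<T0} \<tau> *\<^sub>R (\<beta> \<tau> * (1 - \<mu>0 \<rho> \<tau>))) \<in> borel_measurable borel"
    by (intro borel_measurable_continuous_on_indicator) auto
  also have "(\<lambda>\<tau>. indicator {0<..<T0} \<tau> *\<^sub>R (\<beta> \<tau> * (1 - \<mu>0 \<rho> \<tau>))) = influx"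
    by (auto simp: influx_def fun_eq_iff indicator_def)
  finally show ?thesis .
qed

lemma \<rho>_char:
  assumes t: "0 \<le> t" "t < T0"
  shows "AE a in lborel. 0 < a \<longrightarrow>
    set_integrable lborel {0..min a (t / \<epsilon>)} (\<lambda>s. death (t - \<epsilon> * s) (a - s)) \<and>
    \<rho> t a = along influx \<rho>I0 t a - (LBINT s:{0..min a (t / \<epsilon>)}. death (t - \<epsilon> * s) (a - s))"
proof -
  have "AE a in lborel. 0 < a \<longrightarrow>
        set_integrable lborel {0..min a (t / \<epsilon>)}
          (\<lambda>s. \<zeta> (v (t - \<epsilon> * s) (a - s)) * \<rho> (t - \<epsilon> * s) (a - s)) \<and>
        \<rho> t a =
          (if \<epsilon> * a < t then \<beta> (t - \<epsilon> * a) * (1 - \<mu>0 \<rho> (t - \<epsilon> * a)) else \<rho>I (a - t / \<epsilon>))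
          - (LBINT s:{0..min a (t / \<epsilon>)}.
               \<zeta> (v (t - \<epsilon> * s) (a - s)) * \<rho> (t - \<epsilon> * s) (a - s))"
    using sol t unfolding char_solution_def by auto
  then show ?thesis
  proof eventually_elim
    case (elim a)
    show ?case
    proof
      assume a: "0 < a"
      let ?m = "min a (t / \<epsilon>)"
      let ?g = "\<lambda>s. \<zeta> (v (t - \<epsilon> * s) (a - s)) * \<rho> (t - \<epsilon> * s) (a - s)"
      have g: "set_integrable lborel {0..?m} ?g" using elim a by simp
      \<comment> \<open>On this range the zero extensions can differ from \<open>\<rho>\<close> and
        \<open>v\<close> only at time 0, that is, at the single point
        \<open>s = t / \<epsilon>\<close>.\<close>
      have eq: "AE s\<in>{0..?m} in lborel. ?g s = death (t - \<epsilon> * s) (a - s)"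
        using AE_lborel_singleton[of "t / \<epsilon>"]
      proof eventually_elim
        case (elim s)
        show ?case
        proof
          assume "s \<in> {0..?m}"
          then have s: "0 \<le> s" "s \<le> a" "s < t / \<epsilon>" using elim by auto
          then have "0 < t - \<epsilon> * s" using eps by (simp add: field_simps)
          moreover have "t - \<epsilon> * s < T0" using s eps t by (smt (verit) mult_nonneg_nonneg)
          ultimately show "?g s = death (t - \<epsilon> * s) (a - s)"
            using s by (simp add: death_def R_def W_def)
        qed
      qed
      have m1: "set_borel_measurable lborel {0..?m} ?g"
        using g by (auto simp: set_integrable_def set_borel_measurable_def dest: borel_measurable_integrable)
      have m2: "set_borel_measurable lborel {0..?m} (\<lambda>s. death (t - \<epsilon> * s) (a - s))"
        unfolding set_borel_measurable_def by measurable
      have bd: "along influx \<rho>I0 t a =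
          (if \<epsilon> * a < t then \<beta> (t - \<epsilon> * a) * (1 - \<mu>0 \<rho> (t - \<epsilon> * a)) else \<rho>I (a - t / \<epsilon>))"
        unfolding along_def using eps a t
        by (auto simp: influx_def \<rho>I0_def field_simps) (smt (verit) mult_pos_pos)
      show "set_integrable lborel {0..?m} (\<lambda>s. death (t - \<epsilon> * s) (a - s)) \<and>
        \<rho> t a = along influx \<rho>I0 t a - (LBINT s:{0..?m}. death (t - \<epsilon> * s) (a - s))"
        using elim a g set_integral_cong_AE_on[OF m1 m2 eq] bd
        by simp
    qed
  qed
qed

end

section \<open>Affine changes of variables\<close>

lemma set_integral_Icc_shift:
  fixes F :: "real \<Rightarrow> real"
  shows "(LBINT u:{p..q}. F (s + u)) = (LBINT x:{s + p..s + q}. F x)"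
proof -
  have "(LBINT x:{s + p..s + q}. F x) = (LBINT u. indicator {s + p..s + q} (s + 1 * u) *\<^sub>R F (s + 1 * u))"
    unfolding set_lebesgue_integral_def by (subst lborel_integral_real_affine[of 1 _ s]) auto
  also have "\<dots> = (LBINT u:{p..q}. F (s + u))"
    unfolding set_lebesgue_integral_def
    by (auto intro!: Bochner_Integration.integral_cong simp: indicator_def)
  finally show ?thesis by simp
qed

lemma set_integral_Icc_reflect:
  fixes F :: "real \<Rightarrow> real"
  assumes "0 < \<epsilon>"
  shows "set_integrable lborel {p..q} (\<lambda>s. F (t - \<epsilon> * s)) \<longleftrightarrow>
      set_integrable lborel {t - \<epsilon> * q..t - \<epsilon> * p} F" (is ?I)
    and "(LBINT s:{p..q}. F (t - \<epsilon> * s)) = 1 / \<epsilon> * (LBINT \<tau>:{t - \<epsilon> * q..t - \<epsilon> * p}. F \<tau>)" (is ?E)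
proof -
  have ind: "indicator {t - \<epsilon> * q..t - \<epsilon> * p} (t + (- \<epsilon>) * s) *\<^sub>R F (t + (- \<epsilon>) * s) =
      indicator {p..q} s *\<^sub>R F (t - \<epsilon> * s)" for s
    using assms by (auto simp: indicator_def)
  have "- \<epsilon> \<noteq> 0" using assms by simp
  note aff = lborel_integrable_real_affine_iff[OF this, of "\<lambda>\<tau>. indicator {t - \<epsilon> * q..t - \<epsilon> * p} \<tau> *\<^sub>R F \<tau>" t, unfolded ind]
    lborel_integral_real_affine[OF this, of "\<lambda>\<tau>. indicator {t - \<epsilon> * q..t - \<epsilon> * p} \<tau> *\<^sub>R F \<tau>" t, unfolded ind]
  show ?I using aff(1) by (simp add: set_integrable_def)
  show ?E using aff(2) assms by (simp add: set_lebesgue_integral_def)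
qed

lemma AE_lborel_shift:
  assumes "AE b in lborel. Q b" and [measurable]: "Measurable.pred borel Q"
  shows "AE a in lborel. Q (a - d :: real)"
proof -
  have "AE a in lborel. Q (- d + 1 * a)"
    by (rule AE_borel_affine[OF _ _ assms(1)]) auto
  then show ?thesis by simp
qed

section \<open>The density along characteristics\<close>

context age_system
begin

text \<open>All points of a characteristic share the same foot, so the formula at an interior point
  has the same datum and an integral over the remaining piece of the line. Multiplied by
  \<open>\<zeta>\<close>, it becomes the equation for \<open>death\<close> that
  \<open>volterra_nonneg\<close> requires.\<close>

lemma R_char_along:
  assumes t: "0 \<le> t" "t < T0"
  shows "AE a in lborel. AE s in lborel. 0 < s \<and> s < min a (t / \<epsilon>) \<longrightarrow>
    R (t - \<epsilon> * s) (a - s) = along influx \<rho>I0 t a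
      - (LBINT x:{s..min a (t / \<epsilon>)}. death (t - \<epsilon> * x) (a - x))"
proof -
  define P where "P = (\<lambda>\<tau> b. R \<tau> b = along influx \<rho>I0 \<tau> b -
    (LBINT s:{0..min b (\<tau> / \<epsilon>)}. death (\<tau> - \<epsilon> * s) (b - s)))"
  have "AE a in lborel. AE s in lborel. 0 < s \<and> s < min a (t / \<epsilon>) \<longrightarrow> P (t - \<epsilon> * s) (a - s)"
  proof (rule AE_characteristics)
    show "Measurable.pred (borel \<Otimes>\<^sub>M borel) (\<lambda>x. P (fst x) (snd x))"
    proof -
      have [measurable]: "(\<lambda>x. along influx \<rho>I0 (fst x) (snd x)) \<in> borel_measurable (borel \<Otimes>\<^sub>M borel)"
        unfolding along_def by measurable
      have [measurable]: "(\<lambda>x. LBINT s:{0..min (snd x) (fst x / \<epsilon>)}. death (fst x - \<epsilon> * s) (snd x - s))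
          \<in> borel_measurable (borel \<Otimes>\<^sub>M borel)"
        unfolding set_lebesgue_integral_def indicator_def atLeastAtMost_iff by measurable
      show ?thesis unfolding P_def by measurable
    qed
    fix \<tau> assume "0 < \<tau>" "\<tau> < t"
    with t \<rho>_char[of \<tau>] show "AE b in lborel. 0 < b \<longrightarrow> P \<tau> b"
      by (auto simp: P_def R_def elim!: eventually_mono)
  qed (rule eps)
  then show ?thesis
  proof eventually_elim
    case (elim a)
    then show ?case
    proof eventually_elim
      case (elim s)
      show ?case
      proof
        assume s: "0 < s \<and> s < min a (t / \<epsilon>)"
        have "min (a - s) ((t - \<epsilon> * s) / \<epsilon>) = min a (t / \<epsilon>) - s"
          using eps by (auto simp: diff_divide_distrib min_def)
        then have "(LBINT u:{0..min (a - s) ((t - \<epsilon> * s) / \<epsilon>)}. death (t - \<epsilon> * s - \<epsilon> * u) (a - s - u)) =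
            (LBINT u:{0..min a (t / \<epsilon>) - s}. death (t - \<epsilon> * (s + u)) (a - (s + u)))"
          by (simp only: distrib_left diff_diff_eq)
        also have "\<dots> = (LBINT x:{s..min a (t / \<epsilon>)}. death (t - \<epsilon> * x) (a - x))"
          by (subst set_integral_Icc_shift[of _ _ "\<lambda>x. death (t - \<epsilon> * x) (a - x)"]) simp
        finally show "R (t - \<epsilon> * s) (a - s) = along influx \<rho>I0 t a
            - (LBINT x:{s..min a (t / \<epsilon>)}. death (t - \<epsilon> * x) (a - x))"
          using elim s along_char[of s a t] by (simp add: P_def)
      qed
    qed
  qed
qed

text \<open>On almost every characteristic \<open>death\<close> solves a Volterra equation whose
  datum is nonnegative: \<open>\<rho>I0\<close> is, and the influx is as long as
  \<open>\<mu>0 \<rho>\<close> is at most 1. That bound is asked only before time \<open>t\<close>,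
  which is what the first-exit argument in \<open>\<mu>0_less_1\<close> can offer.\<close>

lemma \<rho>_nonneg:
  assumes t: "0 \<le> t" "t < T0" and le1: "\<And>\<tau>. 0 < \<tau> \<Longrightarrow> \<tau> < t \<Longrightarrow> \<mu>0 \<rho> \<tau> \<le> 1"
  shows "AE a in lborel. 0 < a \<longrightarrow> 0 \<le> \<rho> t a"
proof -
  have "AE a in lborel. 0 \<le> \<rho>I0 (a - t / \<epsilon>)"
    by (rule AE_lborel_shift[OF \<rho>I0_nonneg]) measurable
  with \<rho>_char[OF t] R_char_along[OF t] show ?thesis
  proof eventually_elim
    case (elim a)
    show ?case
    proof
      assume a: "0 < a"
      let ?m = "min a (t / \<epsilon>)"
      let ?g = "\<lambda>s. death (t - \<epsilon> * s) (a - s)"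
      have m: "0 \<le> ?m" using a t eps by simp
      have c: "0 \<le> along influx \<rho>I0 t a"
      proof (cases "\<epsilon> * a < t")
        case True
        then have \<tau>: "0 < t - \<epsilon> * a" "t - \<epsilon> * a < t" using a eps by auto
        have "0 \<le> \<beta> (t - \<epsilon> * a)" using A3 \<tau> by (smt (verit) assumption_A3_def)
        then have "0 \<le> influx (t - \<epsilon> * a)" using le1[OF \<tau>] by (simp add: influx_def)
        then show ?thesis using True by (simp add: along_def)
      qed (use elim in \<open>simp add: along_def\<close>)
      have "0 \<le> along influx \<rho>I0 t a - (LBINT x:{0..?m}. ?g x)"
      proof (rule volterra_nonneg[OF _ m c, where k = "\<lambda>s. \<zeta> (W (t - \<epsilon> * s) (a - s))"])
        show "set_integrable lborel {0..?m} ?g" using elim a by simp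
        show "AE s in lborel. s \<in> {0<..<?m} \<longrightarrow>
          ?g s = \<zeta> (W (t - \<epsilon> * s) (a - s)) * (along influx \<rho>I0 t a - (LBINT x:{s..?m}. ?g x))"
          using elim(2) by eventually_elim (auto simp: death_def)
      qed (rule zeta_nonneg)
      then show "0 \<le> \<rho> t a" using elim a by simp
    qed
  qed
qed

lemma R_nonneg_along:
  assumes t: "0 \<le> t" "t < T0" and le1: "\<And>\<tau>. 0 < \<tau> \<Longrightarrow> \<tau> < t \<Longrightarrow> \<mu>0 \<rho> \<tau> \<le> 1"
  shows "AE a in lborel. AE s in lborel. 0 < s \<and> s < min a (t / \<epsilon>) \<longrightarrow> 0 \<le> R (t - \<epsilon> * s) (a - s)"
proof (rule AE_characteristics)
  show "Measurable.pred (borel \<Otimes>\<^sub>M borel) (\<lambda>x. 0 \<le> R (fst x) (snd x))"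
    by measurable
  fix \<tau> assume "0 < \<tau>" "\<tau> < t"
  with t \<rho>_nonneg[of \<tau>] le1 show "AE b in lborel. 0 < b \<longrightarrow> 0 \<le> R \<tau> b"
    by (auto simp: R_def elim!: eventually_mono)
qed (rule eps)

section \<open>The transport identity for weights that are constant along characteristics\<close>

lemma along_influx_mult:
  "along influx \<rho>I0 t a * along B I t a = along (\<lambda>\<tau>. influx \<tau> * B \<tau>) (\<lambda>b. \<rho>I0 b * I b) t a"
  by (simp add: along_def)

lemma along_meas [measurable (raw)]:
  assumes [measurable]: "B \<in> borel_measurable borel" "I \<in> borel_measurable borel"
    "g \<in> borel_measurable M" "h \<in> borel_measurable M"
  shows "(\<lambda>x. along B I (g x) (h x)) \<in> borel_measurable M"
  unfolding along_def by measurable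

text \<open>Ages below \<open>t / \<epsilon>\<close> are reflected to birth times in [0, t], which
  produces the Jacobian 1/\<epsilon>; larger ages are translated back to initial ages.\<close>

lemma integral_along:
  assumes t: "0 \<le> t" and [measurable]: "B \<in> borel_measurable borel" "I \<in> borel_measurable borel"
    and iB: "set_integrable lborel {0..t} B" and iI: "set_integrable lborel {0..} I"
  shows "set_integrable lborel {0..} (along B I t)"
    and "(LBINT a:{0..}. along B I t a) = 1 / \<epsilon> * (LBINT \<tau>:{0..t}. B \<tau>) + (LBINT a:{0..}. I a)"
proof -
  have 1: "set_integrable lborel {0..t / \<epsilon>} (\<lambda>a. B (t - \<epsilon> * a))"
    "(LBINT a:{0..t / \<epsilon>}. B (t - \<epsilon> * a)) = 1 / \<epsilon> * (LBINT \<tau>:{0..t}. B \<tau>)"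
    using set_integral_Icc_reflect[OF eps, of 0 "t / \<epsilon>" B t] eps iB by auto
  have ind: "indicator {0..} (- (t / \<epsilon>) + 1 * a) *\<^sub>R I (- (t / \<epsilon>) + 1 * a) =
      indicator {t / \<epsilon>..} a *\<^sub>R I (a - t / \<epsilon>)" for a
    by (auto simp: indicator_def)
  have 2: "set_integrable lborel {t / \<epsilon>..} (\<lambda>a. I (a - t / \<epsilon>))"
    "(LBINT a:{t / \<epsilon>..}. I (a - t / \<epsilon>)) = (LBINT a:{0..}. I a)"
    using lborel_integrable_real_affine_iff[of 1 "\<lambda>a. indicator {0..} a *\<^sub>R I a" "- (t / \<epsilon>)", unfolded ind]
      lborel_integral_real_affine[of 1 "\<lambda>a. indicator {0..} a *\<^sub>R I a" "- (t / \<epsilon>)", unfolded ind] iI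
    by (auto simp: set_integrable_def set_lebesgue_integral_def)
  have eq: "AE a in lborel. indicator {0..} a *\<^sub>R along B I t a =
      indicator {0..t / \<epsilon>} a *\<^sub>R B (t - \<epsilon> * a) + indicator {t / \<epsilon>..} a *\<^sub>R I (a - t / \<epsilon>)"
    using AE_lborel_singleton[of "t / \<epsilon>"]
  proof eventually_elim
    case (elim a)
    show ?case
    proof (cases "0 \<le> a")
      case True
      then show ?thesis using elim eps t
        by (auto simp: along_def indicator_def field_simps not_less)
    next
      case False
      moreover have "0 \<le> t / \<epsilon>" using t eps by simp
      ultimately show ?thesis by simp
    qed
  qed
  have m: "(\<lambda>a. indicator {0..} a *\<^sub>R along B I t a) \<in> borel_measurable lborel"
    "(\<lambda>a. indicator {0..t / \<epsilon>} a *\<^sub>R B (t - \<epsilon> * a) + indicator {t / \<epsilon>..} a *\<^sub>R I (a - t / \<epsilon>))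
      \<in> borel_measurable lborel"
    by measurable
  have sum: "integrable lborel
      (\<lambda>a. indicator {0..t / \<epsilon>} a *\<^sub>R B (t - \<epsilon> * a) + indicator {t / \<epsilon>..} a *\<^sub>R I (a - t / \<epsilon>))"
    using 1(1) 2(1) unfolding set_integrable_def by (rule Bochner_Integration.integrable_add)
  show "set_integrable lborel {0..} (along B I t)"
    unfolding set_integrable_def using integrable_cong_AE[OF m eq] sum by simp
  have "(LBINT a:{0..}. along B I t a) = (LBINT a:{0..t / \<epsilon>}. B (t - \<epsilon> * a)) + (LBINT a:{t / \<epsilon>..}. I (a - t / \<epsilon>))"
    unfolding set_lebesgue_integral_def integral_cong_AE[OF m eq]
    by (rule Bochner_Integration.integral_add) (use 1(1) 2(1) in \<open>auto simp: set_integrable_def\<close>)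
  then show "(LBINT a:{0..}. along B I t a) = 1 / \<epsilon> * (LBINT \<tau>:{0..t}. B \<tau>) + (LBINT a:{0..}. I a)"
    using 1(2) 2(2) by simp
qed

text \<open>This is \<open>\<epsilon> \<partial>\<^sub>t (\<rho>\<theta>) + \<partial>\<^sub>a (\<rho>\<theta>) + \<zeta>(v) \<rho>\<theta> = 0\<close> integrated over age and time: the weight \<open>\<theta>\<close> passes
  through the differential operator.\<close>

lemma transport_identity:
  fixes B I :: "real \<Rightarrow> real"
  defines "\<theta> \<equiv> along B I"
  assumes t: "0 \<le> t" "t < T0" and le1: "\<And>\<tau>. 0 < \<tau> \<Longrightarrow> \<tau> < t \<Longrightarrow> \<mu>0 \<rho> \<tau> \<le> 1"
    and [measurable]: "B \<in> borel_measurable borel" "I \<in> borel_measurable borel"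
    and iB: "set_integrable lborel {0..t} (\<lambda>\<tau>. influx \<tau> * B \<tau>)"
    and iI: "set_integrable lborel {0..} (\<lambda>a. \<rho>I0 a * I a)"
  shows "set_integrable lborel {0..t} (\<lambda>\<tau>. LBINT a:{0..}. death \<tau> a * \<theta> \<tau> a)" (is ?I1)
    and "set_integrable lborel {0..} (\<lambda>a. \<rho> t a * \<theta> t a)" (is ?I2)
    and "(LBINT a:{0..}. \<rho> t a * \<theta> t a) + 1 / \<epsilon> * (LBINT \<tau>:{0..t}. LBINT a:{0..}. death \<tau> a * \<theta> \<tau> a) =
      1 / \<epsilon> * (LBINT \<tau>:{0..t}. influx \<tau> * B \<tau>) + (LBINT a:{0..}. \<rho>I0 a * I a)" (is ?E)
proof -
  \<comment> \<open>Here \<open>a\<close> labels the characteristic through (t, a) and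
    \<open>s\<close> measures how far it is followed back. Integrating over \<open>s\<close> first
    brings in the formula for \<open>\<rho>\<close>; integrating over \<open>a\<close> first returns
    an age integral at time t - \<epsilon> s.\<close>
  define X where "X = (\<lambda>a s. indicator {s. 0 < s \<and> s < min a (t / \<epsilon>)} s *
    (death (t - \<epsilon> * s) (a - s) * \<theta> (t - \<epsilon> * s) (a - s)))"
  define E where "E = (\<lambda>a. indicator {0..} a * (along influx \<rho>I0 t a * \<theta> t a))"
  have [measurable]: "\<theta> t \<in> borel_measurable borel"
    unfolding \<theta>_def by measurable
  have [measurable]: "(\<lambda>x. X (fst x) (snd x)) \<in> borel_measurable (borel \<Otimes>\<^sub>M borel)"
    unfolding X_def \<theta>_def indicator_def mem_Collect_eq by measurable
  have X_meas: "case_prod X \<in> borel_measurable (lborel \<Otimes>\<^sub>M lborel)"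
    by (simp add: measurable_lborel_pair split_beta')
  have X_sec [measurable]: "X a \<in> borel_measurable borel" for a
    unfolding X_def \<theta>_def indicator_def mem_Collect_eq by measurable
  have E: "integrable lborel E" "integral\<^sup>L lborel E =
      1 / \<epsilon> * (LBINT \<tau>:{0..t}. influx \<tau> * B \<tau>) + (LBINT a:{0..}. \<rho>I0 a * I a)"
    using integral_along[OF t(1) _ _ iB iI]
    unfolding E_def \<theta>_def along_influx_mult set_integrable_def set_lebesgue_integral_def by auto
  have \<rho>_pos: "AE a in lborel. 0 < a \<longrightarrow> 0 \<le> \<rho> t a"
    by (rule \<rho>_nonneg[OF t le1])
  have R_pos: "AE a in lborel. AE s in lborel. 0 < s \<and> s < min a (t / \<epsilon>) \<longrightarrow> 0 \<le> R (t - \<epsilon> * s) (a - s)"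
    by (rule R_nonneg_along[OF t le1])
  \<comment> \<open>Absolute integrability comes from signs: \<open>\<theta>\<close> is constant on
    the line and \<open>death\<close> is nonnegative, so the integral of the norm is
    \<open>\<bar>\<theta> t a\<bar>\<close> times the datum minus \<open>\<rho> t a\<close>, and
    dropping \<open>\<rho> t a \<ge> 0\<close> leaves at most the norm of
    \<open>E a\<close>.\<close>
  have core: "AE a in lborel. integrable lborel (X a) \<and> (LBINT s. norm (X a s)) \<le> norm (E a) \<and>
      (LBINT s. X a s) = E a - indicator {0..} a * (\<rho> t a * \<theta> t a)"
    using \<rho>_char[OF t] \<rho>_pos R_pos AE_lborel_singleton[of 0]
  proof eventually_elim
    case (elim a)
    show ?case
    proof (cases "0 < a")
      case False
      then have "a < 0" using elim by simp
      then have "X a = (\<lambda>s. 0)" by (auto simp: X_def indicator_def fun_eq_iff)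
      then show ?thesis using \<open>a < 0\<close> by (simp add: E_def)
    next
      case True
      let ?m = "min a (t / \<epsilon>)"
      let ?g = "\<lambda>s. death (t - \<epsilon> * s) (a - s)"
      have g: "set_integrable lborel {0..?m} ?g"
        and \<rho>: "\<rho> t a = along influx \<rho>I0 t a - (LBINT s:{0..?m}. ?g s)" and pos: "0 \<le> \<rho> t a"
        using elim True by auto
      have eq: "AE s in lborel. X a s = \<theta> t a * (indicator {0..?m} s *\<^sub>R ?g s)"
        using AE_lborel_singleton[of 0] AE_lborel_singleton[of ?m]
        by eventually_elim (auto simp: X_def \<theta>_def indicator_def along_char)
      have i1: "integrable lborel (\<lambda>s. \<theta> t a * (indicator {0..?m} s *\<^sub>R ?g s))"
        using g unfolding set_integrable_def by (rule integrable_mult_right)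
      have mg: "(\<lambda>s. \<theta> t a * (indicator {0..?m} s *\<^sub>R ?g s)) \<in> borel_measurable lborel"
        using i1 by (rule borel_measurable_integrable)
      have iX: "integrable lborel (X a)"
        using integrable_cong_AE[OF _ mg eq] i1 by simp
      have eX: "(LBINT s. X a s) = \<theta> t a * (along influx \<rho>I0 t a - \<rho> t a)"
        using integral_cong_AE[OF _ mg eq] \<rho> by (simp add: set_lebesgue_integral_def)
      have eqn: "AE s in lborel. norm (X a s) = \<bar>\<theta> t a\<bar> * (indicator {0..?m} s *\<^sub>R ?g s)"
        using elim(3) AE_lborel_singleton[of 0] AE_lborel_singleton[of ?m]
        by eventually_elim
          (auto simp: X_def \<theta>_def indicator_def along_char abs_mult death_def zeta_nonneg)
      have mn: "(\<lambda>s. \<bar>\<theta> t a\<bar> * (indicator {0..?m} s *\<^sub>R ?g s)) \<in> borel_measurable lborel"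
        by (rule borel_measurable_times[OF borel_measurable_const])
          (use g in \<open>auto simp: set_integrable_def dest: borel_measurable_integrable\<close>)
      have "(LBINT s. norm (X a s)) = \<bar>\<theta> t a\<bar> * (along influx \<rho>I0 t a - \<rho> t a)"
        using integral_cong_AE[OF _ mn eqn] \<rho> by (simp add: set_lebesgue_integral_def)
      also have "\<dots> \<le> \<bar>\<theta> t a\<bar> * \<bar>along influx \<rho>I0 t a\<bar>"
        using pos by (intro mult_left_mono) auto
      also have "\<dots> = norm (E a)" using True by (simp add: E_def abs_mult)
      finally show ?thesis using iX eX True by (simp add: E_def algebra_simps)
    qed
  qed
  have iX: "integrable (lborel \<Otimes>\<^sub>M lborel) (case_prod X)"
  proof (rule lborel_pair.Fubini_integrable[OF X_meas])
    have m: "(\<lambda>a. LBINT s. norm (X a s)) \<in> borel_measurable lborel"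
      by (rule lborel.borel_measurable_lebesgue_integral) (use X_meas in \<open>simp add: split_beta'\<close>)
    show "integrable lborel (\<lambda>a. LBINT s. norm (case (a, s) of (x, xa) \<Rightarrow> X x xa))"
      by (rule Bochner_Integration.integrable_bound[OF E(1)])
        (use m core in \<open>auto elim!: eventually_mono\<close>)
    show "AE a in lborel. integrable lborel (\<lambda>s. case (a, s) of (x, xa) \<Rightarrow> X x xa)"
      using core by eventually_elim simp
  qed
  define J where "J = (\<lambda>\<tau>. LBINT a:{0..}. death \<tau> a * \<theta> \<tau> a)"
  have inner: "(LBINT a. X a s) = indicator {0<..<t / \<epsilon>} s * J (t - \<epsilon> * s)" for s
  proof (cases "0 < s \<and> s < t / \<epsilon>")
    case True
    have "(LBINT a. X a s) = (LBINT a. X (s + 1 * a) s)"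
      by (subst lborel_integral_real_affine[of 1 _ s]) auto
    also have "\<dots> = J (t - \<epsilon> * s)"
      unfolding J_def set_lebesgue_integral_def
    proof (rule integral_cong_AE)
      show "(\<lambda>a. X (s + 1 * a) s) \<in> borel_measurable lborel"
        unfolding X_def \<theta>_def indicator_def mem_Collect_eq by measurable
      show "(\<lambda>a. indicat_real {0..} a *\<^sub>R (death (t - \<epsilon> * s) a * \<theta> (t - \<epsilon> * s) a)) \<in> borel_measurable lborel"
        unfolding \<theta>_def by measurable
      show "AE a in lborel. X (s + 1 * a) s = indicat_real {0..} a *\<^sub>R (death (t - \<epsilon> * s) a * \<theta> (t - \<epsilon> * s) a)"
        using AE_lborel_singleton[of 0] by eventually_elim (use True in \<open>auto simp: X_def indicator_def\<close>)
    qed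
    finally show ?thesis using True by simp
  next
    case False
    then have "X a s = 0" for a by (auto simp: X_def indicator_def)
    then show ?thesis using False by simp
  qed
  have J_meas [measurable]: "J \<in> borel_measurable borel"
    unfolding J_def \<theta>_def set_lebesgue_integral_def by measurable
  have Js_eq: "AE s in lborel. indicator {0<..<t / \<epsilon>} s * J (t - \<epsilon> * s) = indicator {0..t / \<epsilon>} s *\<^sub>R J (t - \<epsilon> * s)"
    using AE_lborel_singleton[of 0] AE_lborel_singleton[of "t / \<epsilon>"]
    by eventually_elim (auto simp: indicator_def)
  have iJs: "set_integrable lborel {0..t / \<epsilon>} (\<lambda>s. J (t - \<epsilon> * s))"
    using lborel_pair.integrable_snd[OF iX] integrable_cong_AE[OF _ _ Js_eq]
    unfolding inner set_integrable_def by simp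
  have J_int: "(LBINT s. LBINT a. X a s) = 1 / \<epsilon> * (LBINT \<tau>:{0..t}. J \<tau>)"
  proof -
    have "(LBINT s. LBINT a. X a s) = (LBINT s:{0..t / \<epsilon>}. J (t - \<epsilon> * s))"
      unfolding inner set_lebesgue_integral_def by (rule integral_cong_AE[OF _ _ Js_eq]) auto
    also have "\<dots> = 1 / \<epsilon> * (LBINT \<tau>:{0..t}. J \<tau>)"
      using set_integral_Icc_reflect(2)[OF eps, of 0 "t / \<epsilon>" J t] eps by simp
    finally show ?thesis .
  qed
  show ?I1 unfolding J_def[symmetric]
    using set_integral_Icc_reflect(1)[OF eps, of 0 "t / \<epsilon>" J t] eps iJs by simp
  have K: "integrable lborel (\<lambda>a. LBINT s. X a s)"
    using lborel_pair.integrable_fst[OF iX] .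
  have Req: "AE a in lborel. E a - (LBINT s. X a s) = indicator {0..} a *\<^sub>R (\<rho> t a * \<theta> t a)"
    using core by eventually_elim simp
  have "(\<lambda>a. indicator {0..} a *\<^sub>R (\<rho> t a)) \<in> borel_measurable lborel"
    using \<rho>_integrable[OF t] by (auto simp: set_integrable_def dest: borel_measurable_integrable)
  then have "(\<lambda>a. (indicator {0..} a *\<^sub>R (\<rho> t a)) * \<theta> t a) \<in> borel_measurable lborel"
    by (intro borel_measurable_times) auto
  then have Rm: "(\<lambda>a. indicator {0..} a *\<^sub>R (\<rho> t a * \<theta> t a)) \<in> borel_measurable lborel"
    by (simp add: mult.assoc)
  have EK: "integrable lborel (\<lambda>a. E a - (LBINT s. X a s))"
    using E(1) K by (rule Bochner_Integration.integrable_diff)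
  show ?I2 unfolding set_integrable_def
    using integrable_cong_AE[OF borel_measurable_integrable[OF EK] Rm Req] EK by simp
  have "(LBINT a:{0..}. \<rho> t a * \<theta> t a) = (LBINT a. E a - (LBINT s. X a s))"
    unfolding set_lebesgue_integral_def
    by (rule integral_cong_AE[OF borel_measurable_integrable[OF EK] Rm Req, symmetric])
  also have "\<dots> = integral\<^sup>L lborel E - (LBINT a. LBINT s. X a s)"
    using E(1) K by (rule Bochner_Integration.integral_diff)
  also have "(LBINT a. LBINT s. X a s) = (LBINT s. LBINT a. X a s)"
    using lborel_pair.Fubini_integral[OF iX] by simp
  finally show ?E using J_int E(2) by (simp add: J_def)
qed

end

text \<open>The constant \<open>D\<close> cancels in \<open>g - u\<close>, which leaves the
  inequality of \<open>gronwall_nonpos\<close> with rate \<open>- \<kappa>\<close>.\<close>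

lemma gronwall_compare:
  fixes g u :: "real \<Rightarrow> real"
  assumes cont: "continuous_on {0..b} g"
    and step: "\<And>s t. 0 \<le> s \<Longrightarrow> s \<le> t \<Longrightarrow> t \<le> b \<Longrightarrow> g t - g s \<le> (LBINT x:{s..t}. - \<kappa> * g x - D)"
    and u: "\<And>x. (u has_real_derivative - \<kappa> * u x - D) (at x)"
    and init: "g 0 \<le> u 0" and t: "0 \<le> t" "t \<le> b"
  shows "g t \<le> u t"
proof -
  have ucont: "continuous_on S u" for S
    by (intro continuous_at_imp_continuous_on ballI DERIV_isCont[OF u])
  have "g t - u t \<le> 0"
  proof (rule gronwall_nonpos[OF _ _ _ t, where \<kappa> = "- \<kappa>"])
    show "continuous_on {0..b} (\<lambda>t. g t - u t)" by (intro continuous_intros cont ucont)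
    show "g 0 - u 0 \<le> 0" using init by simp
    fix s t :: real assume st: "0 \<le> s" "s \<le> t" "t \<le> b"
    have iu: "set_integrable lborel {s..t} (\<lambda>x. - \<kappa> * u x - D)"
      by (rule borel_integrable_atLeastAtMost') (intro continuous_intros ucont)
    have "continuous_on {0..b} (\<lambda>x. - \<kappa> * g x - D)" by (intro continuous_intros cont)
    then have ig: "set_integrable lborel {s..t} (\<lambda>x. - \<kappa> * g x - D)"
      by (rule continuous_imp_set_integrable_Icc) (use st in auto)
    have "(LBINT x:{s..t}. - \<kappa> * u x - D) = u t - u s"
      unfolding set_lebesgue_integral_def
    proof (rule integral_FTC_atLeastAtMost[OF st(2)])
      show "(u has_vector_derivative - \<kappa> * u x - D) (at x within {s..t})" for x
        using u[of x] by (simp add: has_real_derivative_iff_has_vector_derivative has_vector_derivative_at_within)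
      show "continuous_on {s..t} (\<lambda>x. - \<kappa> * u x - D)" by (intro continuous_intros ucont)
    qed
    then have "(g t - u t) - (g s - u s) \<le>
        (LBINT x:{s..t}. - \<kappa> * g x - D) - (LBINT x:{s..t}. - \<kappa> * u x - D)"
      using step[OF st] by simp
    also have "\<dots> = (LBINT x:{s..t}. (- \<kappa> * g x - D) - (- \<kappa> * u x - D))"
      by (rule set_integral_diff(2)[OF ig iu, symmetric])
    also have "\<dots> = (LBINT x:{s..t}. - \<kappa> * (g x - u x))" by (simp add: algebra_simps)
    also have "\<dots> = - \<kappa> * (LBINT x:{s..t}. g x - u x)" by (rule set_integral_mult_right)
    finally show "(g t - u t) - (g s - u s) \<le> - \<kappa> * (LBINT x:{s..t}. g x - u x)" .
  qed
  then show ?thesis by simp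
qed

lemma set_integrable_imp_measurable:
  "set_integrable M A f \<Longrightarrow> set_borel_measurable M A f"
  by (auto simp: set_integrable_def set_borel_measurable_def dest: borel_measurable_integrable)

section \<open>Balance of the total population and the bounds 0 < \<open>\<mu>0 \<rho>\<close> <
  1\<close>

context age_system
begin

definition deaths :: "real \<Rightarrow> real" where
  "deaths \<tau> = (LBINT a:{0..}. death \<tau> a)"

lemma death_eq: "0 < \<tau> \<Longrightarrow> \<tau> < T0 \<Longrightarrow> 0 \<le> a \<Longrightarrow> death \<tau> a = \<zeta> (v \<tau> a) * \<rho> \<tau> a"
  by (simp add: death_def R_def W_def)

lemma influx_cont_integrable:
  assumes t: "t < T0" and B: "continuous_on {0..t} B"
  shows "set_integrable lborel {0..t} (\<lambda>\<tau>. influx \<tau> * B \<tau>)"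
proof -
  have "continuous_on {0..t} (\<lambda>\<tau>. \<beta> \<tau> * (1 - \<mu>0 \<rho> \<tau>) * B \<tau>)"
    using A3 t by (intro continuous_intros B continuous_on_subset[OF \<mu>0_cont])
      (auto simp: assumption_A3_def intro: continuous_on_subset)
  then have i: "set_integrable lborel {0..t} (\<lambda>\<tau>. \<beta> \<tau> * (1 - \<mu>0 \<rho> \<tau>) * B \<tau>)"
    by (rule borel_integrable_atLeastAtMost')
  have ae: "AE \<tau> in lborel. \<tau> \<in> {0..t} \<longrightarrow> influx \<tau> * B \<tau> = \<beta> \<tau> * (1 - \<mu>0 \<rho> \<tau>) * B \<tau>"
    using AE_lborel_singleton[of 0] by eventually_elim (use t in \<open>auto simp: influx_def\<close>)
  have m: "set_borel_measurable lborel {0..t} (\<lambda>\<tau>. influx \<tau> * B \<tau>)"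
  proof -
    have "(\<lambda>\<tau>. indicator {0..t} \<tau> *\<^sub>R B \<tau>) \<in> borel_measurable borel"
      by (rule borel_measurable_continuous_on_indicator[OF _ B]) auto
    then have "(\<lambda>\<tau>. influx \<tau> * (indicator {0..t} \<tau> *\<^sub>R B \<tau>)) \<in> borel_measurable borel"
      by measurable
    then show ?thesis by (simp add: set_borel_measurable_def mult.left_commute)
  qed
  show ?thesis
    using set_integral_cong_AE_on(1)[OF m set_integrable_imp_measurable[OF i] ae] i by simp
qed

lemma \<rho>I0_integrable: "set_integrable lborel {0..} \<rho>I0" "(LBINT a:{0..}. \<rho>I0 a) = (LBINT a:{0..}. \<rho>I a)"
  "set_integrable lborel {0..} (\<lambda>a. a * \<rho>I0 a)"
proof -
  have ind: "indicator {0..} a *\<^sub>R \<rho>I0 a = indicator {0..} a *\<^sub>R \<rho>I a"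
    "indicator {0..} a *\<^sub>R (a * \<rho>I0 a) = indicator {0..} a *\<^sub>R (a ^ 1 * \<rho>I a)" for a
    by (auto simp: indicator_def \<rho>I0_def)
  show "set_integrable lborel {0..} \<rho>I0" "(LBINT a:{0..}. \<rho>I0 a) = (LBINT a:{0..}. \<rho>I a)"
    "set_integrable lborel {0..} (\<lambda>a. a * \<rho>I0 a)"
    using A2 unfolding set_integrable_def set_lebesgue_integral_def ind
    by (auto simp: assumption_A2_def set_integrable_def)
qed

lemma \<mu>0_initial: "\<mu>0 \<rho> 0 = (LBINT a:{0..}. \<rho>I0 a)"
  unfolding \<mu>0_def
proof (rule set_integral_cong_AE_on(2))
  show "set_borel_measurable lborel {0..} (\<rho> 0)"
    using \<rho>_integrable[of 0] T0_pos by (simp add: set_integrable_imp_measurable)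
  show "set_borel_measurable lborel {0..} \<rho>I0" by (simp add: set_borel_measurable_def)
  have "AE s in lborel. indicator {0..0::real} s *\<^sub>R death (- \<epsilon> * s) (a - s) = 0" for a
    using AE_lborel_singleton[of 0] by eventually_elim (auto simp: indicator_def)
  then have 0: "(LBINT s:{0..0}. death (- \<epsilon> * s) (a - s)) = 0" for a
    unfolding set_lebesgue_integral_def by (rule integral_eq_zero_AE)
  show "AE a in lborel. a \<in> {0..} \<longrightarrow> \<rho> 0 a = \<rho>I0 a"
    using \<rho>_char[of 0, OF _ T0_pos, simplified] AE_lborel_singleton[of 0]
  proof eventually_elim
    case (elim a)
    show ?case
    proof
      assume "a \<in> {0..}"
      then have a: "0 < a" using elim by auto
      then have "min a 0 = 0" by simp
      then show "\<rho> 0 a = \<rho>I0 a"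
        using elim a 0[of a] eps by (auto simp: along_def mult_less_0_iff)
    qed
  qed
qed

lemma \<mu>0_initial_bounds: "0 < \<mu>0 \<rho> 0" "\<mu>0 \<rho> 0 < 1"
  using A2 \<mu>0_initial \<rho>I0_integrable(2) by (auto simp: assumption_A2_def)

text \<open>This is \<open>transport_identity\<close> with weight 1. The assumption on earlier times
  guarantees the sign of \<open>\<rho>\<close>; \<open>\<mu>0_increment\<close> discharges it once
  \<open>\<mu>0_less_1\<close> is known.\<close>

lemma \<mu>0_balance_aux:
  assumes t: "0 \<le> t" "t < T0" and le1: "\<And>\<tau>. 0 < \<tau> \<Longrightarrow> \<tau> < t \<Longrightarrow> \<mu>0 \<rho> \<tau> \<le> 1"
  shows "set_integrable lborel {0..t} deaths"
    and "\<mu>0 \<rho> t - \<mu>0 \<rho> 0 = 1 / \<epsilon> * (LBINT \<tau>:{0..t}. influx \<tau> - deaths \<tau>)"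
proof -
  have 1: "along (\<lambda>_. 1) (\<lambda>_. 1) = (\<lambda>_ _. 1)" by (auto simp: along_def fun_eq_iff)
  have i: "set_integrable lborel {0..t} (\<lambda>\<tau>. influx \<tau> * 1)"
    by (rule influx_cont_integrable[OF t(2)]) simp
  note T = transport_identity[OF t le1, of "\<lambda>_. 1" "\<lambda>_. 1", unfolded 1, OF _ _ _ _ i]
  show id: "set_integrable lborel {0..t} deaths"
    using T(1) \<rho>I0_integrable(1) by (simp add: deaths_def[abs_def])
  have "\<mu>0 \<rho> t + 1 / \<epsilon> * (LBINT \<tau>:{0..t}. deaths \<tau>) = 1 / \<epsilon> * (LBINT \<tau>:{0..t}. influx \<tau>) + \<mu>0 \<rho> 0"
    using T(3) \<rho>I0_integrable(1) by (simp add: deaths_def \<mu>0_def[of \<rho> t] \<mu>0_initial)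
  then show "\<mu>0 \<rho> t - \<mu>0 \<rho> 0 = 1 / \<epsilon> * (LBINT \<tau>:{0..t}. influx \<tau> - deaths \<tau>)"
    using i id by (simp add: right_diff_distrib)
qed

lemma \<mu>0_increment_aux:
  assumes st: "0 \<le> s" "s \<le> t" "t < T0" and le1: "\<And>\<tau>. 0 < \<tau> \<Longrightarrow> \<tau> < t \<Longrightarrow> \<mu>0 \<rho> \<tau> \<le> 1"
  shows "set_integrable lborel {s..t} (\<lambda>\<tau>. influx \<tau> - deaths \<tau>)"
    and "\<mu>0 \<rho> t - \<mu>0 \<rho> s = 1 / \<epsilon> * (LBINT \<tau>:{s..t}. influx \<tau> - deaths \<tau>)"
proof -
  have t: "0 \<le> t" "s < T0" using st by auto
  note bt = \<mu>0_balance_aux[OF t(1) st(3) le1]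
  have bs: "\<mu>0 \<rho> s - \<mu>0 \<rho> 0 = 1 / \<epsilon> * (LBINT \<tau>:{0..s}. influx \<tau> - deaths \<tau>)"
    by (rule \<mu>0_balance_aux(2)[OF st(1) t(2)]) (use le1 st in auto)
  have i: "set_integrable lborel {0..t} (\<lambda>\<tau>. influx \<tau> - deaths \<tau>)"
    using influx_cont_integrable[OF st(3), of "\<lambda>_. 1"] bt(1) by simp
  then show "set_integrable lborel {s..t} (\<lambda>\<tau>. influx \<tau> - deaths \<tau>)"
    by (rule set_integrable_subset) (use st in auto)
  show "\<mu>0 \<rho> t - \<mu>0 \<rho> s = 1 / \<epsilon> * (LBINT \<tau>:{s..t}. influx \<tau> - deaths \<tau>)"
    using bt(2) bs set_integral_Icc_split[OF i st(1,2)] by (simp add: algebra_simps)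
qed

lemma deaths_nonneg_aux:
  assumes t: "0 \<le> t" "t < T0" and le1: "\<And>\<tau>. 0 < \<tau> \<Longrightarrow> \<tau> < t \<Longrightarrow> \<mu>0 \<rho> \<tau> \<le> 1"
  shows "0 \<le> deaths t"
  unfolding deaths_def set_lebesgue_integral_def
proof (rule integral_nonneg_AE)
  have "AE a in lborel. 0 < a \<longrightarrow> 0 \<le> \<rho> t a" by (rule \<rho>_nonneg[OF t le1])
  then show "AE a in lborel. 0 \<le> indicat_real {0..} a *\<^sub>R death t a"
    using AE_lborel_singleton[of 0]
    by eventually_elim (auto simp: indicator_def death_def R_def zeta_nonneg)
qed

text \<open>At the first time \<open>r\<close> with \<open>\<mu>0 \<rho> r \<ge> 1\<close> the
  auxiliary lemmas still apply, since they look only at earlier times. Up to \<open>r\<close> the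
  deaths are nonnegative and the influx is at most
  \<open>\<beta>max * (1 - \<mu>0 \<rho> \<tau>)\<close>, so 1 minus the population decays at most
  exponentially with rate \<open>\<beta>max / \<epsilon>\<close> and is still positive at
  \<open>r\<close>.\<close>

lemma \<mu>0_less_1:
  assumes t: "0 \<le> t" "t < T0"
  shows "\<mu>0 \<rho> t < 1"
proof (rule ccontr)
  assume ge: "\<not> \<mu>0 \<rho> t < 1"
  have cont: "continuous_on {0..t} (\<mu>0 \<rho>)" by (rule continuous_on_subset[OF \<mu>0_cont]) (use t in auto)
  define A where "A = {0..t} \<inter> \<mu>0 \<rho> -` {1..}"
  have "closed A" unfolding A_def by (rule continuous_closed_preimage[OF cont]) auto
  then have "compact A" using compact_Int_closed[of "{0..t}" A] by (auto simp: A_def Int_absorb1)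
  moreover have "A \<noteq> {}" using ge t by (auto simp: A_def)
  ultimately obtain r where r: "r \<in> A" "\<And>x. x \<in> A \<Longrightarrow> r \<le> x"
    using compact_attains_inf[of A] by auto
  have r': "0 \<le> r" "r \<le> t" "1 \<le> \<mu>0 \<rho> r" using r(1) by (auto simp: A_def)
  have le1: "\<mu>0 \<rho> \<tau> < 1" if "0 \<le> \<tau>" "\<tau> < r" for \<tau>
    using r(2)[of \<tau>] that r' by (force simp: A_def)
  define \<kappa> where "\<kappa> = \<beta>max / \<epsilon>"
  define u where "u = (\<lambda>x. (\<mu>0 \<rho> 0 - 1) * exp (- \<kappa> * x))"
  have "\<mu>0 \<rho> r - 1 \<le> u r"
  proof (rule gronwall_compare[where g = "\<lambda>x. \<mu>0 \<rho> x - 1" and u = u and \<kappa> = \<kappa> and D = 0 and b = r])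
    show "continuous_on {0..r} (\<lambda>x. \<mu>0 \<rho> x - 1)"
      by (intro continuous_intros continuous_on_subset[OF cont]) (use r' in auto)
    show "(u has_real_derivative - \<kappa> * u x - 0) (at x)" for x
      unfolding u_def by (auto intro!: derivative_eq_intros)
    fix s x :: real assume sx: "0 \<le> s" "s \<le> x" "x \<le> r"
    then have xT: "x < T0" using r' t by simp
    have le: "\<mu>0 \<rho> \<tau> \<le> 1" if "0 < \<tau>" "\<tau> < x" for \<tau>
      using le1[of \<tau>] that sx by simp
    note inc = \<mu>0_increment_aux[OF sx(1,2) xT le]
    have "(LBINT \<tau>:{s..x}. 1 / \<epsilon> * (influx \<tau> - deaths \<tau>)) \<le> (LBINT \<tau>:{s..x}. - \<kappa> * (\<mu>0 \<rho> \<tau> - 1) - 0)"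
    proof (rule set_integral_mono_AE)
      show "set_integrable lborel {s..x} (\<lambda>\<tau>. 1 / \<epsilon> * (influx \<tau> - deaths \<tau>))" using inc(1) by simp
      have "continuous_on {0..t} (\<lambda>\<tau>. - \<kappa> * (\<mu>0 \<rho> \<tau> - 1) - 0)" by (intro continuous_intros cont)
      then show "set_integrable lborel {s..x} (\<lambda>\<tau>. - \<kappa> * (\<mu>0 \<rho> \<tau> - 1) - 0)"
        by (rule continuous_imp_set_integrable_Icc) (use sx r' in auto)
      show "AE \<tau>\<in>{s..x} in lborel. 1 / \<epsilon> * (influx \<tau> - deaths \<tau>) \<le> - \<kappa> * (\<mu>0 \<rho> \<tau> - 1) - 0"
        using AE_lborel_singleton[of 0] AE_lborel_singleton[of r]
      proof eventually_elim
        case (elim \<tau>)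
        show ?case
        proof
          assume "\<tau> \<in> {s..x}"
          then have \<tau>: "0 < \<tau>" "\<tau> < r" "\<tau> < T0" using elim sx r' t by auto
          have "\<mu>0 \<rho> x \<le> 1" if "0 < x" "x < \<tau>" for x
            using le1[of x] that \<tau> by simp
          then have "0 \<le> deaths \<tau>" using \<tau> by (intro deaths_nonneg_aux) auto
          moreover have "influx \<tau> \<le> \<beta>max * (1 - \<mu>0 \<rho> \<tau>)"
            using A3 \<tau> le1[of \<tau>] by (auto simp: influx_def assumption_A3_def intro!: mult_right_mono)
          ultimately have "1 / \<epsilon> * (influx \<tau> - deaths \<tau>) \<le> 1 / \<epsilon> * (\<beta>max * (1 - \<mu>0 \<rho> \<tau>))"
            using eps by (intro mult_left_mono) auto
          then show "1 / \<epsilon> * (influx \<tau> - deaths \<tau>) \<le> - \<kappa> * (\<mu>0 \<rho> \<tau> - 1) - 0"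
            by (simp add: \<kappa>_def algebra_simps)
        qed
      qed
    qed
    then show "\<mu>0 \<rho> x - 1 - (\<mu>0 \<rho> s - 1) \<le> (LBINT \<tau>:{s..x}. - \<kappa> * (\<mu>0 \<rho> \<tau> - 1) - 0)"
      using inc(2) by simp
  qed (use r' in \<open>auto simp: u_def\<close>)
  also have "u r < 0" using \<mu>0_initial_bounds by (simp add: u_def mult_less_0_iff)
  finally show False using r' by simp
qed

text \<open>The notion of solution excludes the value 0, so by the intermediate value theorem the
  population keeps its positive initial sign.\<close>

lemma \<mu>0_pos:
  assumes t: "0 \<le> t" "t < T0"
  shows "0 < \<mu>0 \<rho> t"
proof (rule ccontr)
  assume "\<not> 0 < \<mu>0 \<rho> t"
  then have neg: "\<mu>0 \<rho> t \<le> 0" by simp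
  have cont: "continuous_on {0..t} (\<mu>0 \<rho>)" by (rule continuous_on_subset[OF \<mu>0_cont]) (use t in auto)
  have "\<exists>x\<ge>0. x \<le> t \<and> \<mu>0 \<rho> x = 0"
    by (rule IVT2'[OF neg less_imp_le[OF \<mu>0_initial_bounds(1)] t(1) cont])
  then obtain x where "0 \<le> x" "x \<le> t" "\<mu>0 \<rho> x = 0" by blast
  moreover have "\<forall>t\<in>{0..<T0}. \<mu>0 \<rho> t \<noteq> 0"
    using sol unfolding char_solution_def by (elim conjE)
  ultimately show False using t by simp
qed

lemmas \<mu>0_le_1 = less_imp_le[OF \<mu>0_less_1]

lemma \<rho>_nonneg': "0 \<le> t \<Longrightarrow> t < T0 \<Longrightarrow> AE a in lborel. 0 < a \<longrightarrow> 0 \<le> \<rho> t a"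
  by (rule \<rho>_nonneg; simp add: \<mu>0_le_1)

lemma \<mu>0_increment:
  assumes "0 \<le> s" "s \<le> t" "t < T0"
  shows "set_integrable lborel {s..t} (\<lambda>\<tau>. influx \<tau> - deaths \<tau>)"
    and "\<mu>0 \<rho> t - \<mu>0 \<rho> s = 1 / \<epsilon> * (LBINT \<tau>:{s..t}. influx \<tau> - deaths \<tau>)"
  by (rule \<mu>0_increment_aux[OF assms]; use assms in \<open>auto intro: \<mu>0_le_1\<close>)+

end

subsection \<open>The coupled system\<close>

lemma AE_lborel_obtain_greater:
  assumes "AE x in lborel. P (x::real)"
  obtains x where "c < x" "P x"
proof -
  have "\<exists>x>c. P x"
  proof (rule ccontr)
    assume "\<not> (\<exists>x>c. P x)"
    then have "AE x in lborel. x \<notin> {c<..<c + 1}"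
      using assms by (auto elim!: eventually_mono)
    then have "{c<..<c + 1} \<in> null_sets lborel"
      by (subst AE_iff_null_sets) auto
    then show False by (simp add: null_sets_def)
  qed
  then show ?thesis using that by blast
qed

section \<open>The source of the equation for \<open>v\<close> and its primitive\<close>

context age_system
begin

definition src :: "real \<Rightarrow> real" where
  "src \<tau> = v_source \<epsilon> \<zeta> f \<rho> v \<tau>"

text \<open>Time advances by \<epsilon> per unit of age along a characteristic; the factor
  1/\<epsilon> converts the age integral of the source into a time integral.\<close>

definition V :: "real \<Rightarrow> real" where
  "V t = 1 / \<epsilon> * (LBINT \<tau>:{0..t}. src \<tau>)"

definition deaths_v :: "real \<Rightarrow> real" where
  "deaths_v \<tau> = (LBINT a:{0..}. death \<tau> a * v \<tau> a)"

lemma v_char_raw: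
  assumes t: "0 \<le> t" "t < T0"
  shows "AE a in lborel. 0 < a \<longrightarrow>
        set_integrable lborel {0..min a (t / \<epsilon>)} (\<lambda>s. src (t - \<epsilon> * s)) \<and>
        v t a = (if \<epsilon> * a < t then 0 else vI (a - t / \<epsilon>))
          + (LBINT s:{0..min a (t / \<epsilon>)}. src (t - \<epsilon> * s))"
proof -
  have "\<forall>t\<in>{0..<T0}. AE a in lborel. 0 < a \<longrightarrow>
        set_integrable lborel {0..min a (t / \<epsilon>)} (\<lambda>s. v_source \<epsilon> \<zeta> f \<rho> v (t - \<epsilon> * s)) \<and>
        v t a =
          (if \<epsilon> * a < t then 0 else vI (a - t / \<epsilon>))
          + (LBINT s:{0..min a (t / \<epsilon>)}. v_source \<epsilon> \<zeta> f \<rho> v (t - \<epsilon> * s))"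
    using sol unfolding char_solution_def by (elim conjE)
  then show ?thesis using t unfolding src_def by simp
qed

text \<open>The source depends on time only, so one single age beyond \<open>t / \<epsilon>\<close>
  at which the characteristic formula holds gives integrability over all of [0, t].\<close>

lemma src_integrable:
  assumes t: "0 \<le> t" "t < T0"
  shows "set_integrable lborel {0..t} src"
proof -
  obtain a where a: "t / \<epsilon> < a"
    "0 < a \<longrightarrow> set_integrable lborel {0..min a (t / \<epsilon>)} (\<lambda>s. src (t - \<epsilon> * s)) \<and>
        v t a = (if \<epsilon> * a < t then 0 else vI (a - t / \<epsilon>))
          + (LBINT s:{0..min a (t / \<epsilon>)}. src (t - \<epsilon> * s))"
    using AE_lborel_obtain_greater[OF v_char_raw[OF t], of "t / \<epsilon>"] by metis
  have "0 \<le> t / \<epsilon>" using t eps by simp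
  then have "0 < a" "min a (t / \<epsilon>) = t / \<epsilon>" using a(1) by auto
  then have "set_integrable lborel {0..t / \<epsilon>} (\<lambda>s. src (t - \<epsilon> * s))" using a(2) by simp
  then show ?thesis using set_integral_Icc_reflect(1)[OF eps, of 0 "t / \<epsilon>" src t] eps by simp
qed

lemma v_eq:
  assumes t: "0 \<le> t" "t < T0"
  shows "AE a in lborel. 0 < a \<longrightarrow> v t a = (if \<epsilon> * a < t then 0 else vI (a - t / \<epsilon>))
          + 1 / \<epsilon> * (LBINT \<tau>:{t - min t (\<epsilon> * a)..t}. src \<tau>)"
  using v_char_raw[OF t]
proof eventually_elim
  case (elim a)
  have "t - \<epsilon> * min a (t / \<epsilon>) = t - min t (\<epsilon> * a)"
    using eps by (auto simp: min_def field_simps)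
  then have "(LBINT s:{0..min a (t / \<epsilon>)}. src (t - \<epsilon> * s)) = 1 / \<epsilon> * (LBINT \<tau>:{t - min t (\<epsilon> * a)..t}. src \<tau>)"
    using set_integral_Icc_reflect(2)[OF eps, of 0 "min a (t / \<epsilon>)" src t] by simp
  then show ?case using elim by simp
qed

lemma V_0: "V 0 = 0"
proof -
  have "(LBINT \<tau>:{0..0}. src \<tau>) = 0"
    unfolding set_lebesgue_integral_def
    by (rule integral_eq_zero_AE) (use AE_lborel_singleton[of 0] in \<open>auto elim!: eventually_mono\<close>)
  then show ?thesis by (simp add: V_def)
qed

text \<open>The integral of the source over the line is \<open>V t\<close> minus \<open>V\<close> at
  the time of the foot; for lines that start at time 0 the latter vanishes by
  \<open>V_0\<close>.\<close>

lemma v_along: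
  assumes t: "0 \<le> t" "t < T0"
  shows "AE a in lborel. 0 < a \<longrightarrow> v t a = V t + along (\<lambda>\<tau>. - V \<tau>) vI t a"
  using v_eq[OF t]
proof eventually_elim
  case (elim a)
  show ?case
  proof
    assume a: "0 < a"
    have "0 < \<epsilon> * a" using a eps by simp
    then have "(LBINT \<tau>:{0..t}. src \<tau>) =
        (LBINT \<tau>:{0..t - min t (\<epsilon> * a)}. src \<tau>) + (LBINT \<tau>:{t - min t (\<epsilon> * a)..t}. src \<tau>)"
      by (intro set_integral_Icc_split[OF src_integrable[OF t]]) (use t in auto)
    then have "1 / \<epsilon> * (LBINT \<tau>:{t - min t (\<epsilon> * a)..t}. src \<tau>) = V t - V (t - min t (\<epsilon> * a))"
      by (simp add: V_def algebra_simps)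
    then show "v t a = V t + along (\<lambda>\<tau>. - V \<tau>) vI t a"
      using elim a V_0 by (auto simp: along_def min_def)
  qed
qed

lemma deaths_v_integrable:
  assumes t: "0 < t" "t < T0"
  shows "set_integrable lborel {0..} (\<lambda>a. death t a * v t a)"
    and "deaths_v t = (LBINT a:{0..}. \<zeta> (v t a) * v t a * \<rho> t a)"
proof -
  have ind: "indicator {0..} a *\<^sub>R (death t a * v t a) = indicator {0..} a *\<^sub>R (\<zeta> (v t a) * v t a * \<rho> t a)" for a
    using t by (auto simp: indicator_def death_eq)
  have "\<forall>t\<in>{0<..<T0}. set_integrable lborel {0..} (\<lambda>a. \<zeta> (v t a) * v t a * \<rho> t a)"
    using sol unfolding char_solution_def by (elim conjE)
  then show "set_integrable lborel {0..} (\<lambda>a. death t a * v t a)"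
    using t unfolding set_integrable_def ind by simp
  show "deaths_v t = (LBINT a:{0..}. \<zeta> (v t a) * v t a * \<rho> t a)"
    unfolding deaths_v_def set_lebesgue_integral_def ind ..
qed

lemma src_balance:
  assumes t: "0 < t" "t < T0"
  shows "\<mu>0 \<rho> t * src t = \<epsilon> * deriv f t + deaths_v t"
  using \<mu>0_pos[of t] t by (simp add: src_def v_source_def deaths_v_integrable(2))

text \<open>Where \<open>\<bar>v\<bar> \<le> 1\<close>, continuity bounds \<open>\<zeta> v\<close>
  by a constant and \<open>\<rho>\<close> dominates; elsewhere \<open>death\<close> is dominated by
  \<open>death * v\<close>, whose integrability belongs to the notion of solution.\<close>

lemma death_integrable:
  assumes t: "0 < t" "t < T0"
  shows "set_integrable lborel {0..} (death t)"
proof -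
  obtain C where C: "\<And>u. u \<in> {-1..1} \<Longrightarrow> \<zeta> u \<le> C"
    using continuous_attains_sup[OF compact_Icc _ continuous_on_subset[OF zeta_cont], of "-1" 1] by (metis UNIV_I atLeastAtMost_iff empty_iff neg_le_0_iff_le order_refl subsetI zero_le_one)
  have i: "integrable lborel (\<lambda>a. C * (indicator {0..} a *\<^sub>R \<bar>\<rho> t a\<bar>) + indicator {0..} a *\<^sub>R \<bar>death t a * v t a\<bar>)"
    using set_integrable_abs[OF \<rho>_integrable[of t]] set_integrable_abs[OF deaths_v_integrable(1)[OF t]] t
    by (intro Bochner_Integration.integrable_add integrable_mult_right) (auto simp: set_integrable_def)
  show ?thesis unfolding set_integrable_def
  proof (rule Bochner_Integration.integrable_bound[OF i])
    show "(\<lambda>a. indicator {0..} a *\<^sub>R death t a) \<in> borel_measurable lborel" by measurable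
    show "AE a in lborel. norm (indicator {0..} a *\<^sub>R death t a)
        \<le> norm (C * (indicator {0..} a *\<^sub>R \<bar>\<rho> t a\<bar>) + indicator {0..} a *\<^sub>R \<bar>death t a * v t a\<bar>)"
    proof (rule AE_I2)
      fix a :: real
      have "0 \<le> C" using C[of 0] zeta_nonneg[of 0] by simp
      show "norm (indicator {0..} a *\<^sub>R death t a)
        \<le> norm (C * (indicator {0..} a *\<^sub>R \<bar>\<rho> t a\<bar>) + indicator {0..} a *\<^sub>R \<bar>death t a * v t a\<bar>)"
      proof (cases "0 \<le> a")
        case True
        have "\<bar>death t a\<bar> \<le> C * \<bar>\<rho> t a\<bar> + \<bar>death t a * v t a\<bar>"
        proof (cases "\<bar>v t a\<bar> \<le> 1")
          case le: True
          then have "\<zeta> (v t a) * \<bar>\<rho> t a\<bar> \<le> C * \<bar>\<rho> t a\<bar>"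
            by (intro mult_right_mono C) auto
          then show ?thesis using t True
            by (auto simp: death_eq abs_mult zeta_nonneg intro!: add_increasing2 mult_nonneg_nonneg)
        next
          case False
          then have "\<bar>death t a\<bar> * 1 \<le> \<bar>death t a\<bar> * \<bar>v t a\<bar>"
            by (intro mult_left_mono) auto
          then show ?thesis using \<open>0 \<le> C\<close> by (simp add: abs_mult add_increasing)
        qed
        then show ?thesis using True by simp
      qed simp
    qed
  qed
qed

end

locale coupled_system = age_system +
  fixes L T :: real
  assumes vI_weighted: "weighted_ess_bounded vI"
    and vI_nonneg: "AE a in lborel. 0 \<le> a \<longrightarrow> 0 \<le> vI a"
    and f_0: "f 0 = (LBINT a:{0..}. \<rho>I a * vI a)"
    and zeta_lip: "\<And>u w. \<bar>\<zeta> u - \<zeta> w\<bar> \<le> L * \<bar>u - w\<bar>"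
    and f_lip: "\<And>S. 0 < S \<Longrightarrow> \<exists>K. K-lipschitz_on {0..S} f"
    and f_incr: "AE t in lborel. t \<in> {0<..<T} \<longrightarrow> f differentiable (at t) \<and> 0 < deriv f t"
begin

section \<open>The sign of \<open>v\<close>, and the identity that the age integral of \<rho> v is
  \<open>f\<close>\<close>

definition vI0 :: "real \<Rightarrow> real" where
  "vI0 a = (if 0 \<le> a then vI a else 0)"

lemma vI0_meas [measurable]: "vI0 \<in> borel_measurable borel"
proof -
  have "(\<lambda>a. indicator {0..} a *\<^sub>R (vI a * \<omega> a)) \<in> borel_measurable borel"
    using vI_weighted by (simp add: weighted_ess_bounded_def ess_bounded_def set_borel_measurable_def)
  then have "(\<lambda>a. (indicator {0..} a *\<^sub>R (vI a * \<omega> a)) * (1 + a)) \<in> borel_measurable borel"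
    by measurable
  also have "(\<lambda>a. (indicator {0..} a *\<^sub>R (vI a * \<omega> a)) * (1 + a)) = vI0"
    by (auto simp: vI0_def \<omega>_def indicator_def fun_eq_iff)
  finally show ?thesis .
qed

lemma vI0_nonneg: "AE a in lborel. 0 \<le> vI0 a"
  using vI_nonneg by eventually_elim (auto simp: vI0_def)

text \<open>The weight allows \<open>vI\<close> to grow linearly in age, which the first moment of
  \<open>\<rho>I\<close> absorbs.\<close>

lemma \<rho>I0_vI0: "set_integrable lborel {0..} (\<lambda>a. \<rho>I0 a * vI0 a)" "(LBINT a:{0..}. \<rho>I0 a * vI0 a) = f 0"
proof -
  obtain C where C: "AE a in lborel. 0 \<le> a \<longrightarrow> \<bar>vI a * \<omega> a\<bar> \<le> C"
    using vI_weighted by (auto simp: weighted_ess_bounded_def ess_bounded_def)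
  have i: "integrable lborel (\<lambda>a. C * (indicator {0..} a *\<^sub>R \<rho>I0 a + indicator {0..} a *\<^sub>R (a * \<rho>I0 a)))"
    using \<rho>I0_integrable(1,3)
    by (intro Bochner_Integration.integrable_add integrable_mult_right) (auto simp: set_integrable_def)
  show "set_integrable lborel {0..} (\<lambda>a. \<rho>I0 a * vI0 a)"
    unfolding set_integrable_def
  proof (rule Bochner_Integration.integrable_bound[OF i])
    show "(\<lambda>a. indicator {0..} a *\<^sub>R (\<rho>I0 a * vI0 a)) \<in> borel_measurable lborel" by measurable
    show "AE a in lborel. norm (indicator {0..} a *\<^sub>R (\<rho>I0 a * vI0 a)) \<le>
        norm (C * (indicator {0..} a *\<^sub>R \<rho>I0 a + indicator {0..} a *\<^sub>R (a * \<rho>I0 a)))"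
      using C \<rho>I0_nonneg
    proof eventually_elim
      case (elim a)
      show ?case
      proof (cases "0 \<le> a")
        case True
        then have "\<bar>vI a\<bar> \<le> C * (1 + a)" using elim by (simp add: \<omega>_def field_simps)
        then have "\<rho>I0 a * \<bar>vI a\<bar> \<le> \<rho>I0 a * (C * (1 + a))" using elim by (intro mult_left_mono) auto
        also have "\<dots> = C * (\<rho>I0 a + a * \<rho>I0 a)" by (simp add: algebra_simps)
        also have "\<dots> \<le> norm (C * (\<rho>I0 a + a * \<rho>I0 a))" by simp
        finally show ?thesis using True elim by (simp add: vI0_def abs_mult)
      qed simp
    qed
  qed
  have ind: "indicator {0..} a *\<^sub>R (\<rho>I0 a * vI0 a) = indicator {0..} a *\<^sub>R (\<rho>I a * vI a)" for a
    by (auto simp: indicator_def \<rho>I0_def vI0_def)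
  show "(LBINT a:{0..}. \<rho>I0 a * vI0 a) = f 0"
    unfolding f_0 set_lebesgue_integral_def ind ..
qed

lemma v_nonneg:
  assumes t: "0 \<le> t" "t < T0" "t \<le> T"
  shows "AE a in lborel. 0 < a \<longrightarrow> 0 \<le> v t a"
proof -
  \<comment> \<open>\<open>n\<close> is the negative part of the source. Since the data of
    \<open>v\<close> are nonnegative, its accumulated amount \<open>N r\<close> bounds how far
    \<open>v\<close> can be below 0 at time \<open>r\<close>.\<close>
  define n where "n = (\<lambda>x. (\<bar>src x\<bar> - src x) / 2)"
  define N where "N = (\<lambda>r. 1 / \<epsilon> * (LBINT x:{0..r}. n x))"
  have n: "0 \<le> n x" "- n x \<le> src x" for x by (auto simp: n_def abs_if)
  have n_int: "set_integrable lborel {0..t} n"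
    unfolding n_def
    by (intro set_integrable_divide set_integral_diff(1) set_integrable_abs src_integrable t)
  have n_nonneg: "0 \<le> (LBINT x:A. n x)" for A
    unfolding set_lebesgue_integral_def using n(1) by (intro integral_nonneg_AE) (auto simp: indicator_def)
  have N_inc: "N r - N s = 1 / \<epsilon> * (LBINT x:{s..r}. n x)" if "0 \<le> s" "s \<le> r" "r \<le> t" for s r
  proof -
    have "set_integrable lborel {0..r} n" by (rule set_integrable_subset[OF n_int]) (use that in auto)
    from set_integral_Icc_split[OF this that(1,2)] show ?thesis by (simp add: N_def add_divide_distrib)
  qed
  have N_nonneg: "0 \<le> N r" for r using n_nonneg eps by (simp add: N_def)
  have N_mono: "N s \<le> N r" if "0 \<le> s" "s \<le> r" "r \<le> t" for s r
    using N_inc[OF that] n_nonneg[of "{s..r}"] eps by (smt (verit) mult_nonneg_nonneg divide_nonneg_pos)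
  have N_cont: "continuous_on {0..t} N"
    unfolding N_def by (intro continuous_intros continuous_on_primitive n_int)
  have v_ge: "AE a in lborel. 0 < a \<longrightarrow> - N r \<le> v r a" if r: "0 \<le> r" "r \<le> t" for r
  proof -
    have rT: "r < T0" using r t by simp
    have "AE a in lborel. 0 \<le> vI0 (a - r / \<epsilon>)"
      by (rule AE_lborel_shift[OF vI0_nonneg]) measurable
    with v_eq[OF r(1) rT] show ?thesis
    proof eventually_elim
      case (elim a)
      show ?case
      proof
        assume a: "0 < a"
        let ?s = "r - min r (\<epsilon> * a)"
        have "0 < \<epsilon> * a" using a eps by simp
        then have s: "0 \<le> ?s" "?s \<le> r" using r by auto
        have isub: "{?s..r} \<subseteq> {0..t}" using s r by auto
        have "0 \<le> (if \<epsilon> * a < r then 0 else vI (a - r / \<epsilon>))"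
          using elim eps by (auto simp: vI0_def field_simps split: if_splits)
        moreover have "- (LBINT x:{?s..r}. n x) \<le> (LBINT x:{?s..r}. src x)"
        proof -
          have i: "set_integrable lborel {?s..r} n" "set_integrable lborel {?s..r} src"
            using set_integrable_subset[OF n_int _ isub] set_integrable_subset[OF src_integrable[OF t(1,2)] _ isub]
            by auto
          have "(LBINT x:{?s..r}. - n x) \<le> (LBINT x:{?s..r}. src x)"
            using i n(2) by (intro set_integral_mono) (auto simp: set_integrable_def)
          then show ?thesis using set_integral_uminus[OF i(1)] by simp
        qed
        ultimately have "- (1 / \<epsilon> * (LBINT x:{?s..r}. n x)) \<le> v r a"
          using elim a eps by (simp add: divide_right_mono flip: minus_divide_left)
            (smt (verit) divide_right_mono minus_divide_left)
        moreover have "1 / \<epsilon> * (LBINT x:{?s..r}. n x) \<le> N r"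
          using N_inc[OF s r(2)] N_nonneg[of ?s] by simp
        ultimately show "- N r \<le> v r a" by simp
      qed
    qed
  qed
  \<comment> \<open>By the Lipschitz bound \<open>\<zeta>\<close> is at most \<open>K\<close> on
    [- N t, 0], where the negative values of \<open>v\<close> before time \<open>t\<close> lie
    almost everywhere.\<close>
  define K where "K = \<zeta> 0 + L * N t"
  have "0 \<le> L" using zeta_lip[of 1 0] by simp
  have K: "0 \<le> K" using zeta_nonneg[of 0] \<open>0 \<le> L\<close> N_nonneg[of t] by (simp add: K_def)
  have src_ge: "- (K * N r) \<le> src r" if r: "0 < r" "r < t" and f': "0 < deriv f r" for r
  proof -
    have rT: "0 \<le> r" "r < T0" using r t by auto
    have "(LBINT a:{0..}. - (K * N r) * \<rho> r a) \<le> deaths_v r"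
      unfolding deaths_v_def
    proof (rule set_integral_mono_AE)
      show "set_integrable lborel {0..} (\<lambda>a. - (K * N r) * \<rho> r a)"
        by (intro set_integrable_mult_right \<rho>_integrable rT)
      show "set_integrable lborel {0..} (\<lambda>a. death r a * v r a)"
        using deaths_v_integrable(1) r rT by simp
      show "AE a\<in>{0..} in lborel. - (K * N r) * \<rho> r a \<le> death r a * v r a"
        using v_ge[OF rT(1) less_imp_le[OF r(2)]] \<rho>_nonneg'[OF rT] AE_lborel_singleton[of 0]
      proof eventually_elim
        case (elim a)
        show ?case
        proof
          assume "a \<in> {0..}"
          then have a: "0 < a" using elim by auto
          then have h: "- N r \<le> v r a" "0 \<le> \<rho> r a" using elim r by auto
          have "- (K * N r) \<le> \<zeta> (v r a) * v r a"
          proof (cases "0 \<le> v r a")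
            case True
            then show ?thesis using K N_nonneg[of r] zeta_nonneg[of "v r a"]
              by (smt (verit) mult_nonneg_nonneg)
          next
            case False
            have "\<zeta> (v r a) \<le> \<zeta> 0 + L * \<bar>v r a\<bar>" using zeta_lip[of "v r a" 0] by simp
            also have "\<dots> \<le> K" unfolding K_def
              using False h N_mono[of r t] r \<open>0 \<le> L\<close> by (intro add_left_mono mult_left_mono) auto
            finally have "\<zeta> (v r a) * (- v r a) \<le> K * N r"
              using False h K by (intro mult_mono) auto
            then show ?thesis by simp
          qed
          from mult_right_mono[OF this h(2)]
          show "- (K * N r) * \<rho> r a \<le> death r a * v r a"
            using a r rT by (simp add: death_eq mult_ac)
        qed
      qed
    qed
    then have "- (K * N r) * \<mu>0 \<rho> r \<le> deaths_v r"
      unfolding set_integral_mult_right \<mu>0_def .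
    also have "deaths_v r \<le> \<mu>0 \<rho> r * src r"
      using src_balance[OF r(1) rT(2)] mult_pos_pos[OF eps f'] by linarith
    also have "\<dots> = src r * \<mu>0 \<rho> r" by (rule mult.commute)
    finally show ?thesis by (rule mult_right_le_imp_le[OF _ \<mu>0_pos[OF rT]])
  qed
  have n_le: "AE x in lborel. x \<in> {0..t} \<longrightarrow> n x \<le> K * N x"
    using f_incr AE_lborel_singleton[of 0] AE_lborel_singleton[of t]
  proof eventually_elim
    case (elim x)
    show ?case
    proof
      assume "x \<in> {0..t}"
      then have x: "0 < x" "x < t" using elim by auto
      then have "0 < deriv f x" using elim(1) t(3) by simp
      then have "- (K * N x) \<le> src x" by (rule src_ge[OF x])
      moreover have "0 \<le> K * N x" by (rule mult_nonneg_nonneg[OF K N_nonneg])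
      moreover have "n x = 0 \<or> n x = - src x" by (auto simp: n_def abs_if)
      ultimately show "n x \<le> K * N x" by linarith
    qed
  qed
  have "N t \<le> 0"
  proof (rule gronwall_nonpos[OF N_cont, where \<kappa> = "1 / \<epsilon> * K"])
    fix s r :: real assume sr: "0 \<le> s" "s \<le> r" "r \<le> t"
    have "(LBINT x:{s..r}. n x) \<le> (LBINT x:{s..r}. K * N x)"
    proof (rule set_integral_mono_AE)
      show "set_integrable lborel {s..r} n"
        by (rule set_integrable_subset[OF n_int]) (use sr in auto)
      show "set_integrable lborel {s..r} (\<lambda>x. K * N x)"
        by (intro set_integrable_mult_right continuous_imp_set_integrable_Icc[OF N_cont] sr)
      show "AE x\<in>{s..r} in lborel. n x \<le> K * N x"
        using n_le by eventually_elim (use sr in auto)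
    qed
    then show "N r - N s \<le> 1 / \<epsilon> * K * (LBINT x:{s..r}. N x)"
      using N_inc[OF sr] eps by (simp add: divide_right_mono)
  next
    have "(LBINT x:{0..0}. n x) = 0"
      unfolding set_lebesgue_integral_def
      by (rule integral_eq_zero_AE) (use AE_lborel_singleton[of 0] in \<open>auto elim!: eventually_mono\<close>)
    then show "N 0 \<le> 0" by (simp add: N_def)
  qed (use t in auto)
  then show ?thesis
    using v_ge[OF t(1) order_refl] by (rule_tac eventually_mono) auto
qed

text \<open>With v = V + \<theta>, the mean is V times the population plus the integral of \<rho>
  \<theta>. Multiplied by \<epsilon>, the first term has derivative src \<mu>0 + V (influx - deaths)
  and the second has derivative - influx V - (deaths_v - V deaths). The sum is src \<mu>0 -
  deaths_v, which is \<epsilon> f' by \<open>src_balance\<close>. Everything is carried out in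
  integrated form, and the initial value is \<open>f 0\<close> by
  \<open>\<rho>I0_vI0\<close>.\<close>

lemma v_mean:
  assumes t: "0 < t" "t < T0" "t \<le> T"
  shows "set_integrable lborel {0..} (\<lambda>a. \<rho> t a * v t a)"
    and "(LBINT a:{0..}. \<rho> t a * v t a) = f t"
proof -
  have t0: "0 \<le> t" using t by simp
  define h where "h = (\<lambda>\<tau>. influx \<tau> - deaths \<tau>)"
  \<comment> \<open>Cutting \<open>V\<close> off outside [0, t] yields a Borel function on the whole
    line, as \<open>transport_identity\<close> requires of its boundary weight.\<close>
  define Vt where "Vt = (\<lambda>\<tau>. indicator {0..t} \<tau> *\<^sub>R V \<tau>)"
  define \<theta> where "\<theta> = along (\<lambda>\<tau>. - Vt \<tau>) vI0"
  define G where "G = (\<lambda>\<tau>. LBINT a:{0..}. death \<tau> a * \<theta> \<tau> a)"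
  note src_int = src_integrable[OF t0 t(2)]
  have h_int: "set_integrable lborel {0..t} h"
    using \<mu>0_increment(1)[of 0 t] t by (simp add: h_def)
  have V_cont: "continuous_on {0..t} V"
    unfolding V_def by (intro continuous_intros continuous_on_primitive src_int)
  have Vt_eq: "Vt \<tau> = V \<tau>" if "\<tau> \<in> {0..t}" for \<tau> using that by (simp add: Vt_def)
  have [measurable]: "Vt \<in> borel_measurable borel"
    unfolding Vt_def by (rule borel_measurable_continuous_on_indicator[OF _ V_cont]) auto
  have Vt_cont: "continuous_on {0..t} Vt"
    by (rule continuous_on_eq[OF V_cont]) (simp add: Vt_eq)
  have infl: "set_integrable lborel {0..t} (\<lambda>\<tau>. influx \<tau> * Vt \<tau>)"
    "set_integrable lborel {0..t} (\<lambda>\<tau>. influx \<tau> * - Vt \<tau>)"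
    by (rule influx_cont_integrable[OF t(2)], intro continuous_intros Vt_cont)+
  have le1: "\<mu>0 \<rho> \<tau> \<le> 1" if "0 < \<tau>" "\<tau> < t" for \<tau> using that t by (intro \<mu>0_le_1) auto
  have [measurable]: "(\<lambda>\<tau>. - Vt \<tau>) \<in> borel_measurable borel" by measurable
  note T = transport_identity[OF t0 t(2) le1 _ vI0_meas infl(2) \<rho>I0_vI0(1), folded \<theta>_def,
      unfolded \<rho>I0_vI0(2), simplified]
  have v_\<theta>: "AE a in lborel. 0 < a \<longrightarrow> v \<tau> a = V \<tau> + \<theta> \<tau> a" if \<tau>: "0 < \<tau>" "\<tau> \<le> t" for \<tau>
  proof -
    have "0 \<le> \<tau>" "\<tau> < T0" using \<tau> t by auto
    from v_along[OF this] show ?thesis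
    proof eventually_elim
      case (elim a)
      show ?case
      proof
        assume a: "0 < a"
        then have "0 < \<epsilon> * a" using eps by simp
        then have "along (\<lambda>\<tau>. - V \<tau>) vI \<tau> a = \<theta> \<tau> a"
          unfolding \<theta>_def along_def using \<tau> eps by (auto simp: Vt_eq vI0_def field_simps)
        then show "v \<tau> a = V \<tau> + \<theta> \<tau> a" using elim a by simp
      qed
    qed
  qed
  have G_eq: "G \<tau> = deaths_v \<tau> - V \<tau> * deaths \<tau>" if \<tau>: "0 < \<tau>" "\<tau> < t" for \<tau>
  proof -
    have \<tau>T: "0 < \<tau>" "\<tau> < T0" using \<tau> t by auto
    have i: "set_integrable lborel {0..} (\<lambda>a. V \<tau> * death \<tau> a)"
      by (intro set_integrable_mult_right death_integrable \<tau>T)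
    have "G \<tau> = (LBINT a:{0..}. death \<tau> a * v \<tau> a - V \<tau> * death \<tau> a)"
      unfolding G_def
    proof (rule set_integral_cong_AE_on(2))
      show "set_borel_measurable lborel {0..} (\<lambda>a. death \<tau> a * \<theta> \<tau> a)"
        unfolding set_borel_measurable_def \<theta>_def by measurable
      show "set_borel_measurable lborel {0..} (\<lambda>a. death \<tau> a * v \<tau> a - V \<tau> * death \<tau> a)"
        by (intro set_integrable_imp_measurable set_integral_diff(1) deaths_v_integrable(1) i \<tau>T)
      show "AE a in lborel. a \<in> {0..} \<longrightarrow> death \<tau> a * \<theta> \<tau> a = death \<tau> a * v \<tau> a - V \<tau> * death \<tau> a"
        using v_\<theta>[OF \<tau>(1) less_imp_le[OF \<tau>(2)]] AE_lborel_singleton[of 0]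
        by eventually_elim (auto simp: algebra_simps)
    qed
    also have "\<dots> = deaths_v \<tau> - V \<tau> * deaths \<tau>"
      unfolding deaths_v_def deaths_def
      by (subst set_integral_diff(2)[OF deaths_v_integrable(1)[OF \<tau>T] i]) simp
    finally show ?thesis .
  qed

  have \<rho>v: "AE a in lborel. a \<in> {0..} \<longrightarrow> V t * \<rho> t a + \<rho> t a * \<theta> t a = \<rho> t a * v t a"
    using v_\<theta>[OF t(1) order_refl] AE_lborel_singleton[of 0]
    by eventually_elim (auto simp: algebra_simps)
  have i_V\<rho>: "set_integrable lborel {0..} (\<lambda>a. V t * \<rho> t a)"
    by (intro set_integrable_mult_right \<rho>_integrable t0 t)
  have sum: "set_integrable lborel {0..} (\<lambda>a. V t * \<rho> t a + \<rho> t a * \<theta> t a)"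
    by (intro set_integral_add(1) i_V\<rho> T(2))
  have "(\<lambda>a. R t a * W t a) \<in> borel_measurable lborel"
  proof -
    have "(\<lambda>a. W t a) \<in> borel_measurable lborel"
      using measurable_compose[OF _ W_meas, of "\<lambda>a. (t, a)" lborel] by simp
    then show ?thesis by measurable
  qed
  also have "(\<lambda>a. R t a * W t a) = (\<lambda>a. indicator {0..} a *\<^sub>R (\<rho> t a * v t a))"
    using t by (auto simp: R_def W_def indicator_def fun_eq_iff)
  finally have m: "set_borel_measurable lborel {0..} (\<lambda>a. \<rho> t a * v t a)"
    by (simp add: set_borel_measurable_def)
  note cong = set_integral_cong_AE_on[OF set_integrable_imp_measurable[OF sum] m \<rho>v]
  show "set_integrable lborel {0..} (\<lambda>a. \<rho> t a * v t a)" using cong(1) sum by simp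
  have Q: "(LBINT a:{0..}. \<rho> t a * v t a) = V t * \<mu>0 \<rho> t + (LBINT a:{0..}. \<rho> t a * \<theta> t a)"
    unfolding cong(2)[symmetric] \<mu>0_def
    by (subst set_integral_add(2)[OF i_V\<rho> T(2)]) simp

  have ph: "(LBINT y:{0..x}. h y) = \<epsilon> * (\<mu>0 \<rho> x - \<mu>0 \<rho> 0)" if "x \<in> {0..t}" for x
    using \<mu>0_increment(2)[of 0 x] that t eps by (simp add: h_def)
  have ps: "(LBINT y:{0..x}. src y) = \<epsilon> * V x" for x
    using eps by (simp add: V_def)
  have ind: "indicator {0..t} x *\<^sub>R (src x * (LBINT y:{0..x}. h y)) =
      indicator {0..t} x *\<^sub>R (\<epsilon> * (src x * (\<mu>0 \<rho> x - \<mu>0 \<rho> 0)))"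
    "indicator {0..t} x *\<^sub>R (h x * (LBINT y:{0..x}. src y)) = indicator {0..t} x *\<^sub>R (\<epsilon> * (h x * Vt x))" for x
    using ph[of x] ps[of x] by (auto simp: indicator_def Vt_eq)
  define A1 where "A1 = (LBINT x:{0..t}. src x * (\<mu>0 \<rho> x - \<mu>0 \<rho> 0))"
  define A2 where "A2 = (LBINT x:{0..t}. h x * Vt x)"
  \<comment> \<open>Product rule for V times the population: \<open>src\<close> and \<open>h\<close>
    have as primitives \<epsilon> times \<open>V\<close> and \<epsilon> times the increment of the
    population from its initial value.\<close>
  note pm = primitive_mult[OF src_int h_int, unfolded set_integrable_def set_lebesgue_integral_def[of _ "{0..t}"] ind,
      folded set_integrable_def set_lebesgue_integral_def]
  have i1: "set_integrable lborel {0..t} (\<lambda>x. src x * (\<mu>0 \<rho> x - \<mu>0 \<rho> 0))"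
    and i2: "set_integrable lborel {0..t} (\<lambda>x. h x * Vt x)"
    using pm(1,2) eps by (simp_all only: set_integrable_mult_right_iff)
  have "(\<epsilon> * V t) * (\<epsilon> * (\<mu>0 \<rho> t - \<mu>0 \<rho> 0)) = \<epsilon> * A1 + \<epsilon> * A2"
    using pm(3) ph[of t] ps[of t] t0 by (simp add: A1_def A2_def)
  then have "\<epsilon> * (\<epsilon> * V t * (\<mu>0 \<rho> t - \<mu>0 \<rho> 0)) = \<epsilon> * (A1 + A2)"
    by (simp add: algebra_simps)
  then have prod: "\<epsilon> * V t * (\<mu>0 \<rho> t - \<mu>0 \<rho> 0) = A1 + A2" using eps by simp

  \<comment> \<open>\<open>Z\<close> gathers all integrands under one integral. Pointwise, the terms
    with \<open>V\<close> cancel, \<open>G_eq\<close> removes \<open>deaths_v\<close>, and only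
    \<open>\<epsilon> * d x\<close> is left.\<close>
  define Z where "Z = (\<lambda>x. src x * (\<mu>0 \<rho> x - \<mu>0 \<rho> 0) + \<mu>0 \<rho> 0 * src x + h x * Vt x - G x - influx x * Vt x)"
  have G_int: "set_integrable lborel {0..t} G" using T(1) by (simp add: G_def)
  have i3: "set_integrable lborel {0..t} (\<lambda>x. \<mu>0 \<rho> 0 * src x)"
    by (intro set_integrable_mult_right src_int)
  note s1 = set_integral_add[OF i1 i3] and s2 = set_integral_add[OF set_integral_add(1)[OF i1 i3] i2]
  note s3 = set_integral_diff[OF s2(1) G_int]
  note s4 = set_integral_diff[OF s3(1) infl(1)]
  have Z_int: "set_integrable lborel {0..t} Z" unfolding Z_def by (rule s4(1))
  have Z_val: "(LBINT x:{0..t}. Z x) = A1 + \<mu>0 \<rho> 0 * (\<epsilon> * V t) + A2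
      - (LBINT x:{0..t}. G x) - (LBINT x:{0..t}. influx x * Vt x)"
    unfolding Z_def s4(2) s3(2) s2(2) s1(2) set_integral_mult_right ps A1_def A2_def by (rule refl)
  obtain Lf where Lf: "Lf-lipschitz_on {0..t} f" using f_lip t(1) by blast
  have f_diff: "AE x in lborel. x \<in> {0<..<t} \<longrightarrow> f differentiable (at x)"
    using f_incr by eventually_elim (use t in auto)
  obtain d where d: "set_integrable lborel {0..t} d"
    "AE x in lborel. x \<in> {0<..<t} \<longrightarrow> d x = deriv f x" "(LBINT x:{0..t}. d x) = f t - f 0"
    by (rule lipschitz_FTC[OF Lf t(1) f_diff])
  have "(LBINT x:{0..t}. Z x) = (LBINT x:{0..t}. \<epsilon> * d x)"
  proof (rule set_integral_cong_AE_on(2))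
    show "AE x in lborel. x \<in> {0..t} \<longrightarrow> Z x = \<epsilon> * d x"
      using d(2) AE_lborel_singleton[of 0] AE_lborel_singleton[of t]
    proof eventually_elim
      case (elim x)
      show ?case
      proof
        assume "x \<in> {0..t}"
        then have x: "0 < x" "x < t" using elim by auto
        have "\<mu>0 \<rho> x * src x = \<epsilon> * d x + deaths_v x"
          using src_balance[of x] x t elim by simp
        then show "Z x = \<epsilon> * d x"
          using x by (simp add: Z_def G_eq Vt_eq h_def algebra_simps)
      qed
    qed
  qed (intro set_integrable_imp_measurable Z_int set_integrable_mult_right d)+
  then have Z2: "(LBINT x:{0..t}. Z x) = \<epsilon> * (f t - f 0)" using d(3) by simp
  have "\<epsilon> * (LBINT a:{0..}. \<rho> t a * \<theta> t a) + (LBINT x:{0..t}. G x) = - (LBINT x:{0..t}. influx x * Vt x) + \<epsilon> * f 0"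
  proof -
    have "(LBINT x:{0..t}. influx x * - Vt x) = - (LBINT x:{0..t}. influx x * Vt x)"
      using set_integral_uminus[OF infl(1)] by simp
    moreover have "(LBINT a:{0..}. \<rho> t a * \<theta> t a) + (LBINT x:{0..t}. G x) / \<epsilon> =
        (LBINT x:{0..t}. influx x * - Vt x) / \<epsilon> + f 0"
      using T(3) by (simp add: G_def)
    ultimately show ?thesis using eps by (simp add: field_simps)
  qed
  then have "\<epsilon> * (LBINT a:{0..}. \<rho> t a * v t a) = \<epsilon> * f t"
    using Z_val Z2 prod Q by (simp add: algebra_simps)
  then show "(LBINT a:{0..}. \<rho> t a * v t a) = f t" using eps by simp
qed

section \<open>Upper bound on the population and lower bound on \<open>v\<close>\<close>

lemma deaths_ge:
  assumes t: "0 < t" "t < T0" "t \<le> T" and z: "\<And>u. 0 \<le> u \<Longrightarrow> z0 + z1 * u \<le> \<zeta> u"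
  shows "z0 * \<mu>0 \<rho> t + z1 * f t \<le> deaths t"
proof -
  have t0: "0 \<le> t" using t by simp
  have i: "set_integrable lborel {0..} (\<lambda>a. z0 * \<rho> t a)" "set_integrable lborel {0..} (\<lambda>a. z1 * (\<rho> t a * v t a))"
    by (intro set_integrable_mult_right \<rho>_integrable v_mean t0 t)+
  have "z0 * \<mu>0 \<rho> t + z1 * f t = (LBINT a:{0..}. z0 * \<rho> t a) + (LBINT a:{0..}. z1 * (\<rho> t a * v t a))"
    using v_mean(2)[OF t] by (simp add: \<mu>0_def)
  also have "\<dots> = (LBINT a:{0..}. z0 * \<rho> t a + z1 * (\<rho> t a * v t a))"
    by (rule set_integral_add(2)[OF i, symmetric])
  also have "\<dots> \<le> deaths t"
    unfolding deaths_def
  proof (rule set_integral_mono_AE)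
    show "set_integrable lborel {0..} (\<lambda>a. z0 * \<rho> t a + z1 * (\<rho> t a * v t a))"
      by (rule set_integral_add(1)[OF i])
    show "set_integrable lborel {0..} (death t)" by (rule death_integrable[OF t(1,2)])
    \<comment> \<open>The affine minorant of \<open>\<zeta>\<close> is assumed on nonnegative
      arguments only, which is why the sign of \<open>v\<close> had to be settled first.\<close>
    show "AE a\<in>{0..} in lborel. z0 * \<rho> t a + z1 * (\<rho> t a * v t a) \<le> death t a"
      using v_nonneg[OF t0 t(2,3)] \<rho>_nonneg'[OF t0 t(2)] AE_lborel_singleton[of 0]
    proof eventually_elim
      case (elim a)
      show ?case
      proof
        assume "a \<in> {0..}"
        then have a: "0 < a" using elim by auto
        then have "(z0 + z1 * v t a) * \<rho> t a \<le> \<zeta> (v t a) * \<rho> t a"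
          using elim z by (intro mult_right_mono) auto
        then show "z0 * \<rho> t a + z1 * (\<rho> t a * v t a) \<le> death t a"
          using a t by (simp add: death_eq algebra_simps)
      qed
    qed
  qed
  finally show ?thesis .
qed

text \<open>The bounds on \<open>\<beta>\<close> are used on opposite sides of the factor 1 -
  \<mu>0: the influx is at most \<open>\<beta>max - \<beta>min * \<mu>0 \<rho> \<tau>\<close>.
  Together with \<open>deaths_ge\<close> this gives \<epsilon> \<mu>0' \<le> - k \<mu>0 - D, and the
  bound is the solution of the corresponding equation with the same initial value.\<close>

lemma \<mu>0_upper:
  assumes t: "0 \<le> t" "t < T0" "t \<le> T" and z: "\<And>u. 0 \<le> u \<Longrightarrow> z0 + z1 * u \<le> \<zeta> u" and z1: "0 \<le> z1"
    and fm: "\<And>\<tau>. \<tau> \<in> {0<..<T} \<Longrightarrow> fm \<le> f \<tau>"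
    and k: "k = \<beta>min + z0" "k \<noteq> 0" and D: "D = z1 * fm - \<beta>max"
  shows "\<mu>0 \<rho> t \<le> (\<mu>0 \<rho> 0 + D / k) * exp (- (k / \<epsilon>) * t) - D / k"
proof (rule gronwall_compare[where g = "\<mu>0 \<rho>" and u = "\<lambda>t. (\<mu>0 \<rho> 0 + D / k) * exp (- (k / \<epsilon>) * t) - D / k"
      and \<kappa> = "k / \<epsilon>" and D = "D / \<epsilon>" and b = t])
  show cont: "continuous_on {0..t} (\<mu>0 \<rho>)" by (rule continuous_on_subset[OF \<mu>0_cont]) (use t in auto)
  show "((\<lambda>t. (\<mu>0 \<rho> 0 + D / k) * exp (- (k / \<epsilon>) * t) - D / k) has_real_derivative
      - (k / \<epsilon>) * ((\<mu>0 \<rho> 0 + D / k) * exp (- (k / \<epsilon>) * x) - D / k) - D / \<epsilon>) (at x)" for x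
    using k(2) eps by (auto intro!: derivative_eq_intros simp: field_simps)
  fix s r :: real assume sr: "0 \<le> s" "s \<le> r" "r \<le> t"
  then have rT: "r < T0" using t by simp
  note inc = \<mu>0_increment[OF sr(1,2) rT]
  have "(LBINT \<tau>:{s..r}. 1 / \<epsilon> * (influx \<tau> - deaths \<tau>)) \<le> (LBINT \<tau>:{s..r}. - (k / \<epsilon>) * \<mu>0 \<rho> \<tau> - D / \<epsilon>)"
  proof (rule set_integral_mono_AE)
    show "set_integrable lborel {s..r} (\<lambda>\<tau>. 1 / \<epsilon> * (influx \<tau> - deaths \<tau>))"
      by (rule set_integrable_mult_right) (use inc(1) in simp)
    have "continuous_on {0..t} (\<lambda>\<tau>. - (k / \<epsilon>) * \<mu>0 \<rho> \<tau> - D / \<epsilon>)" by (intro continuous_intros cont)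
    then show "set_integrable lborel {s..r} (\<lambda>\<tau>. - (k / \<epsilon>) * \<mu>0 \<rho> \<tau> - D / \<epsilon>)"
      by (rule continuous_imp_set_integrable_Icc) (use sr in auto)
    show "AE \<tau>\<in>{s..r} in lborel. 1 / \<epsilon> * (influx \<tau> - deaths \<tau>) \<le> - (k / \<epsilon>) * \<mu>0 \<rho> \<tau> - D / \<epsilon>"
      using AE_lborel_singleton[of 0] AE_lborel_singleton[of t]
    proof eventually_elim
      case (elim \<tau>)
      show ?case
      proof
        assume "\<tau> \<in> {s..r}"
        then have \<tau>: "0 < \<tau>" "\<tau> < t" "\<tau> < T0" using elim sr t by auto
        then have \<tau>T: "\<tau> \<le> T" "fm \<le> f \<tau>" using t fm[of \<tau>] by auto
        have \<mu>: "0 < \<mu>0 \<rho> \<tau>" using \<tau> by (intro \<mu>0_pos) auto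
        have \<beta>: "\<beta>min \<le> \<beta> \<tau>" "\<beta> \<tau> \<le> \<beta>max" using A3 \<tau> by (auto simp: assumption_A3_def)
        have "\<beta>min * \<mu>0 \<rho> \<tau> \<le> \<beta> \<tau> * \<mu>0 \<rho> \<tau>" using \<beta> \<mu> by (intro mult_right_mono) auto
        then have "influx \<tau> \<le> \<beta>max - \<beta>min * \<mu>0 \<rho> \<tau>"
          using \<beta> \<tau> by (simp add: influx_def right_diff_distrib)
        moreover have "z0 * \<mu>0 \<rho> \<tau> + z1 * f \<tau> \<le> deaths \<tau>"
          by (rule deaths_ge[OF \<tau>(1,3) \<tau>T(1) z])
        moreover have "z1 * fm \<le> z1 * f \<tau>" using z1 \<tau>T by (intro mult_left_mono) auto
        ultimately have "influx \<tau> - deaths \<tau> \<le> - k * \<mu>0 \<rho> \<tau> - D"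
          by (simp add: k D algebra_simps)
        then have "1 / \<epsilon> * (influx \<tau> - deaths \<tau>) \<le> 1 / \<epsilon> * (- k * \<mu>0 \<rho> \<tau> - D)"
          using eps by (intro mult_left_mono) auto
        then show "1 / \<epsilon> * (influx \<tau> - deaths \<tau>) \<le> - (k / \<epsilon>) * \<mu>0 \<rho> \<tau> - D / \<epsilon>"
          using eps by (simp add: diff_divide_distrib)
      qed
    qed
  qed
  then show "\<mu>0 \<rho> r - \<mu>0 \<rho> s \<le> (LBINT \<tau>:{s..r}. - (k / \<epsilon>) * \<mu>0 \<rho> \<tau> - D / \<epsilon>)"
    using inc(2) by simp
qed (use t in auto)

text \<open>As \<open>deaths_v\<close> is nonnegative, the population times the source is at least
  \<open>\<epsilon> * d\<close>; dividing by the linear bound on the population gives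
  \<open>src \<tau> \<ge> \<epsilon> * (\<gamma> / (t0 - \<tau>))\<close>. The time integral of the
  source enters \<open>v\<close> with factor 1/\<epsilon>, so the logarithm appears with coefficient
  \<open>\<gamma>\<close>, without a factor \<epsilon>.\<close>

lemma v_lower:
  assumes t: "0 < t" "t < T0" "t \<le> T" and t0: "t < t0" and d: "0 \<le> d"
    and f': "AE \<tau> in lborel. \<tau> \<in> {0<..<t} \<longrightarrow> d \<le> deriv f \<tau>"
    and upper: "\<And>\<tau>. \<tau> \<in> {0<..<t} \<Longrightarrow> \<mu>0 \<rho> \<tau> \<le> \<mu>0 \<rho> 0 * (1 - \<tau> / t0)"
    and \<gamma>: "\<gamma> = t0 * d / \<mu>0 \<rho> 0"
  shows "AE a in lborel. 0 < a \<longrightarrow> \<gamma> * ln (1 + min t (\<epsilon> * a) / (t0 - t)) \<le> v t a"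
proof -
  have tt: "0 \<le> t" using t by simp
  have src_ge: "AE \<tau> in lborel. \<tau> \<in> {0..t} \<longrightarrow> \<epsilon> * (\<gamma> / (t0 - \<tau>)) \<le> src \<tau>"
    using f' AE_lborel_singleton[of 0] AE_lborel_singleton[of t]
  proof eventually_elim
    case (elim \<tau>)
    show ?case
    proof
      assume "\<tau> \<in> {0..t}"
      then have \<tau>: "0 < \<tau>" "\<tau> < t" using elim by auto
      then have \<tau>T: "0 \<le> \<tau>" "\<tau> < T0" "\<tau> \<le> T" using t by auto
      have \<mu>: "0 < \<mu>0 \<rho> \<tau>" by (rule \<mu>0_pos[OF \<tau>T(1,2)])
      have "0 \<le> deaths_v \<tau>"
        unfolding deaths_v_def set_lebesgue_integral_def
      proof (rule integral_nonneg_AE)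
        show "AE a in lborel. 0 \<le> indicat_real {0..} a *\<^sub>R (death \<tau> a * v \<tau> a)"
          using v_nonneg[OF \<tau>T] \<rho>_nonneg'[OF \<tau>T(1,2)] AE_lborel_singleton[of 0]
          by eventually_elim (auto simp: indicator_def death_def R_def zeta_nonneg)
      qed
      moreover have "\<epsilon> * d \<le> \<epsilon> * deriv f \<tau>"
        using elim \<tau> eps by (intro mult_left_mono) auto
      ultimately have 1: "\<epsilon> * d \<le> \<mu>0 \<rho> \<tau> * src \<tau>"
        using src_balance[OF \<tau>(1) \<tau>T(2)] by simp
      have 2: "\<mu>0 \<rho> \<tau> * t0 \<le> \<mu>0 \<rho> 0 * (t0 - \<tau>)"
        using upper[of \<tau>] \<tau> t0 by (simp add: field_simps)
      have pos: "0 < \<mu>0 \<rho> 0" "0 < t0 - \<tau>" "0 < t0" using \<mu>0_initial_bounds \<tau> t0 by auto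
      have "\<epsilon> * (\<gamma> / (t0 - \<tau>)) = \<epsilon> * d * (t0 / (\<mu>0 \<rho> 0 * (t0 - \<tau>)))"
        by (simp add: \<gamma>)
      also have "\<dots> \<le> \<epsilon> * d * (1 / \<mu>0 \<rho> \<tau>)"
        using 2 pos \<mu> d eps by (intro mult_left_mono) (auto simp: divide_simps mult.commute)
      also have "\<dots> \<le> src \<tau>" using 1 \<mu> by (simp add: field_simps)
      finally show "\<epsilon> * (\<gamma> / (t0 - \<tau>)) \<le> src \<tau>" .
    qed
  qed
  have "AE a in lborel. 0 \<le> vI0 (a - t / \<epsilon>)"
    by (rule AE_lborel_shift[OF vI0_nonneg]) measurable
  with v_eq[OF tt t(2)] show ?thesis
  proof eventually_elim
    case (elim a)
    show ?case
    proof
      assume a: "0 < a"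
      define m where "m = min t (\<epsilon> * a)"
      have m: "0 < m" "m \<le> t" using a eps t by (auto simp: m_def)
      have vI: "0 \<le> (if \<epsilon> * a < t then 0 else vI (a - t / \<epsilon>))"
        using elim eps by (auto simp: vI0_def field_simps split: if_splits)
      have cont: "continuous_on {t - m..t} (\<lambda>\<tau>. \<gamma> / (t0 - \<tau>))"
        using t0 by (intro continuous_intros) auto
      have "(LBINT \<tau>:{t - m..t}. \<gamma> / (t0 - \<tau>)) = - \<gamma> * ln (t0 - t) - (- \<gamma> * ln (t0 - (t - m)))"
        unfolding set_lebesgue_integral_def
      proof (rule integral_FTC_atLeastAtMost[OF _ _ cont])
        fix \<tau> assume "t - m \<le> \<tau>" "\<tau> \<le> t"
        then have "((\<lambda>\<tau>. - \<gamma> * ln (t0 - \<tau>)) has_real_derivative \<gamma> / (t0 - \<tau>)) (at \<tau>)"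
          using t0 by (auto intro!: derivative_eq_intros)
        then show "((\<lambda>\<tau>. - \<gamma> * ln (t0 - \<tau>)) has_vector_derivative \<gamma> / (t0 - \<tau>)) (at \<tau> within {t - m..t})"
          by (simp add: has_real_derivative_iff_has_vector_derivative has_vector_derivative_at_within)
      qed (use m in simp)
      also have "\<dots> = \<gamma> * (ln (t0 - t + m) - ln (t0 - t))" by (simp add: algebra_simps)
      also have "ln (t0 - t + m) - ln (t0 - t) = ln ((t0 - t + m) / (t0 - t))"
        using m t0 by (simp add: ln_div)
      also have "(t0 - t + m) / (t0 - t) = 1 + m / (t0 - t)" using t0 by (simp add: add_divide_distrib)
      finally have val: "(LBINT \<tau>:{t - m..t}. \<gamma> / (t0 - \<tau>)) = \<gamma> * ln (1 + m / (t0 - t))" .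
      have "(LBINT \<tau>:{t - m..t}. \<epsilon> * (\<gamma> / (t0 - \<tau>))) \<le> (LBINT \<tau>:{t - m..t}. src \<tau>)"
      proof (rule set_integral_mono_AE)
        show "set_integrable lborel {t - m..t} (\<lambda>\<tau>. \<epsilon> * (\<gamma> / (t0 - \<tau>)))"
          by (intro set_integrable_mult_right borel_integrable_atLeastAtMost' cont)
        show "set_integrable lborel {t - m..t} src"
          by (rule set_integrable_subset[OF src_integrable[OF tt t(2)]]) (use m in auto)
        show "AE \<tau>\<in>{t - m..t} in lborel. \<epsilon> * (\<gamma> / (t0 - \<tau>)) \<le> src \<tau>"
          using src_ge by eventually_elim (use m in auto)
      qed
      then have "\<epsilon> * (\<gamma> * ln (1 + m / (t0 - t))) \<le> (LBINT \<tau>:{t - m..t}. src \<tau>)"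
        unfolding set_integral_mult_right val .
      then have "\<gamma> * ln (1 + m / (t0 - t)) \<le> 1 / \<epsilon> * (LBINT \<tau>:{t - m..t}. src \<tau>)"
        using eps by (simp add: field_simps)
      then show "\<gamma> * ln (1 + min t (\<epsilon> * a) / (t0 - t)) \<le> v t a"
        using elim a vI unfolding m_def by linarith
    qed
  qed
qed

end

section \<open>The bound on the existence time and the profile of \<open>v\<close>\<close>

theorem proposition7p3:
  fixes \<epsilon> T T0 t0 \<gamma>6 \<zeta>min \<zeta>Lip \<beta>min \<beta>max \<zeta>c'0 fmin :: real
    and c :: "nat \<Rightarrow> real"
    and \<zeta> \<zeta>c \<beta> f \<rho>I vI :: "real \<Rightarrow> real"
    and \<rho> v :: "real \<Rightarrow> real \<Rightarrow> real"
  assumes "0 < \<epsilon>" and "0 < T"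
    and "weighted_ess_bounded vI"
    and "f 0 = (LBINT a:{0..}. \<rho>I a * vI a)"
    and A2: "assumption_A2 \<rho>I c"
    and A3: "assumption_A3 \<beta> \<beta>min \<beta>max"
    and i_A1: "assumption_A1 \<zeta> \<zeta>min \<zeta>Lip f"
    and i_envelope: "lower_convex_envelope \<zeta> \<zeta>c"
    and i_slope: "(\<zeta>c has_real_derivative \<zeta>c'0) (at_right 0)" "0 < \<zeta>c'0"
    and ii: "AE t in lborel. t \<in> {0<..<T} \<longrightarrow> f differentiable (at t) \<and> 0 < deriv f t"
    and fmin: "fmin = (INF t\<in>{0<..<T}. f t)"
    and iii: "\<beta>max < \<zeta>c'0 * fmin"
    and iv: "AE a in lborel. 0 \<le> a \<longrightarrow> 0 \<le> vI a"
    and solution: "char_solution \<epsilon> \<zeta> \<beta> f \<rho>I vI T0 \<rho> v"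
    and t0: "t0 = \<epsilon> / (\<beta>min + \<zeta>c 0) *
               ln (1 + \<mu>0 \<rho> 0 * (\<beta>min + \<zeta>c 0) / (\<zeta>c'0 * fmin - \<beta>max))"
    and \<gamma>6: "\<gamma>6 = t0 * ess_inf_on {0<..<t0} (deriv f) / \<mu>0 \<rho> 0"
    and horizon: "min T0 t0 \<le> T"
  shows "T0 \<le> t0 \<and>
         (T0 = t0 \<longrightarrow> (\<exists>m\<le>0. (\<mu>0 \<rho> \<longlongrightarrow> m) (at_left t0))) \<and>
         (\<forall>t\<in>{0<..<t0} \<inter> {0<..<T0}. AE a in lborel. 0 < a \<longrightarrow>
            v t a \<ge> \<gamma>6 * ln (1 + min t (\<epsilon> * a) / (t0 - t)) \<and>
            (\<epsilon> \<le> 1 \<longrightarrow> v t a \<ge> \<epsilon> * \<gamma>6 * ln (1 + min t (\<epsilon> * a) / (t0 - t))))"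
proof -
  have \<zeta>: "\<And>u. (\<zeta> has_real_derivative deriv \<zeta> u) (at u)" "\<And>u. \<bar>deriv \<zeta> u\<bar> \<le> \<zeta>Lip"
    "0 < \<zeta>min" "\<And>u. \<zeta>min \<le> \<zeta> u" and f_lip: "\<And>S. 0 < S \<Longrightarrow> \<exists>K. K-lipschitz_on {0..S} f"
    using i_A1 by (auto simp: assumption_A1_def DERIV_deriv_iff_real_differentiable)
  interpret coupled_system \<epsilon> \<zeta> \<beta> f \<rho>I vI T0 \<rho> v c \<beta>min \<beta>max \<zeta>Lip T
  proof unfold_locales
    show "0 \<le> \<zeta> u" for u using \<zeta>(3) \<zeta>(4)[of u] by simp
    show "continuous_on UNIV \<zeta>"
      by (intro continuous_at_imp_continuous_on ballI DERIV_isCont[OF \<zeta>(1)])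
    show "\<bar>\<zeta> u - \<zeta> w\<bar> \<le> \<zeta>Lip * \<bar>u - w\<bar>" for u w
      using field_differentiable_bound[of UNIV \<zeta> "deriv \<zeta>" \<zeta>Lip u w] \<zeta>(1,2) by simp
  qed (use assms f_lip in simp_all)

  define k where "k = \<beta>min + \<zeta>c 0"
  define D where "D = \<zeta>c'0 * fmin - \<beta>max"
  define M where "M = \<mu>0 \<rho> 0"
  define U where "U = (\<lambda>t. (M + D / k) * exp (- (k / \<epsilon>) * t) - D / k)"
  have envelope: "convex_on {0..} \<zeta>c" "\<And>u. 0 \<le> u \<Longrightarrow> \<zeta>c u \<le> \<zeta> u"
    "\<And>h u. convex_on {0..} h \<Longrightarrow> (\<And>u. 0 \<le> u \<Longrightarrow> h u \<le> \<zeta> u) \<Longrightarrow> 0 \<le> u \<Longrightarrow> h u \<le> \<zeta>c u"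
    using i_envelope unfolding lower_convex_envelope_def by blast+
  \<comment> \<open>The constant \<open>\<zeta>min\<close> is a convex minorant of
    \<open>\<zeta>\<close>, hence lies below the envelope; this makes \<open>k\<close>
    positive.\<close>
  have "\<zeta>min \<le> \<zeta>c 0"
    using envelope(3)[of "\<lambda>_. \<zeta>min" 0] \<zeta>(4) by (simp add: convex_on_def flip: distrib_right)
  then have k: "0 < k" using A3 \<zeta>(3) by (simp add: k_def assumption_A3_def)
  have D: "0 < D" using iii by (simp add: D_def)
  have M: "0 < M" using \<mu>0_initial_bounds by (simp add: M_def)
  have t0_eq: "t0 = \<epsilon> / k * ln (1 + M * k / D)"
    by (simp add: t0 k_def D_def M_def)
  have "0 < M * k / D" using M k D by simp
  then have arg: "1 < 1 + M * k / D" by simp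
  then have t0_pos: "0 < t0" using k eps by (simp add: t0_eq)
  have tangent: "\<zeta>c 0 + \<zeta>c'0 * u \<le> \<zeta> u" if "0 \<le> u" for u
    using convex_on_tangent_at_0[OF envelope(1) i_slope(1) that] envelope(2)[OF that] by simp
  \<comment> \<open>Lipschitz continuity bounds \<open>f\<close> from below on the bounded interval,
    so the infimum is a true lower bound.\<close>
  have fmin_le: "fmin \<le> f \<tau>" if "\<tau> \<in> {0<..<T}" for \<tau>
  proof -
    obtain K where K: "K-lipschitz_on {0..T} f" using f_lip \<open>0 < T\<close> by blast
    have "f 0 - K * T \<le> f x" if "x \<in> {0<..<T}" for x
    proof -
      have "\<bar>f x - f 0\<bar> \<le> K * \<bar>x - 0\<bar>"
        using lipschitz_onD[OF K, of x 0] that by (simp add: dist_real_def)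
      also have "\<dots> \<le> K * T" using that lipschitz_on_nonneg[OF K] by (intro mult_left_mono) auto
      finally show ?thesis by linarith
    qed
    then have "bdd_below (f ` {0<..<T})" by (rule bdd_belowI2)
    then show ?thesis unfolding fmin using that by (rule cINF_lower)
  qed
  have upper: "\<mu>0 \<rho> t \<le> U t" if "0 \<le> t" "t < T0" "t \<le> T" for t
    unfolding U_def M_def
    by (rule \<mu>0_upper[OF that tangent _ fmin_le k_def _ D_def]) (use i_slope(2) k in auto)
  \<comment> \<open>The time \<open>t0\<close> is the zero of \<open>U\<close>: solving (M + D/k)
    exp(- k t / \<epsilon>) = D/k for t gives exp(k t / \<epsilon>) = 1 + M k / D.\<close>
  have exp_t0: "exp (- (k / \<epsilon>) * t0) = 1 / (1 + M * k / D)"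
  proof -
    have "- (k / \<epsilon>) * t0 = - ln (1 + M * k / D)" using k eps by (simp add: t0_eq)
    then show ?thesis using arg by (simp add: exp_minus inverse_eq_divide)
  qed
  have "0 < D + M * k" using M k D by (intro add_pos_pos mult_pos_pos)
  then have "(M + D / k) * (1 / (1 + M * k / D)) = D / k"
    using k D by (simp add: divide_simps)
  then have U_t0: "U t0 = 0" by (simp only: U_def exp_t0 diff_self)
  \<comment> \<open>\<open>U\<close> is convex because \<open>M + D / k\<close> is positive, so it
    lies below its chord from (0, M) to (t0, 0).\<close>
  have U_le: "U t \<le> M * (1 - t / t0)" if t: "0 \<le> t" "t \<le> t0" for t
  proof -
    define s where "s = t / t0"
    have s: "0 \<le> s" "s \<le> 1" using t t0_pos by (auto simp: s_def)
    have t_eq: "t = s * t0" using t0_pos by (simp add: s_def)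
    have "exp ((1 - s) *\<^sub>R 0 + s *\<^sub>R (- (k / \<epsilon>) * t0)) \<le> (1 - s) * exp 0 + s * exp (- (k / \<epsilon>) * t0)"
      by (rule convex_onD[OF exp_convex]) (use s in auto)
    then have "exp (- (k / \<epsilon>) * t) \<le> (1 - s) + s * exp (- (k / \<epsilon>) * t0)"
      by (simp add: t_eq mult.left_commute)
    then have "(M + D / k) * exp (- (k / \<epsilon>) * t) \<le> (M + D / k) * ((1 - s) + s * exp (- (k / \<epsilon>) * t0))"
      using M D k by (intro mult_left_mono) auto
    then have "U t \<le> (1 - s) * M + s * U t0" by (simp add: U_def algebra_simps)
    then show ?thesis by (simp add: U_t0 s_def mult.commute)
  qed

  \<comment> \<open>If the solution lived beyond \<open>t0\<close>, then \<open>horizon\<close>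
    would give \<open>t0 \<le> T\<close>, and the upper bound \<open>U t0 = 0\<close> would
    contradict the positivity of the population.\<close>
  have T0_le: "T0 \<le> t0"
  proof (rule ccontr)
    assume "\<not> T0 \<le> t0"
    then have "t0 < T0" "t0 \<le> T" using horizon by auto
    then show False using upper[of t0] \<mu>0_pos[of t0] U_t0 t0_pos by simp
  qed
  then have T0_T: "T0 \<le> T" using horizon by simp
  \<comment> \<open>A solution on [0, \<open>T0\<close>) says nothing about the instant
    \<open>t0\<close> when \<open>T0 = t0\<close>, so the value there is read as a limit from the
    left. It is squeezed between 0 and \<open>U\<close>.\<close>
  have limit: "(\<mu>0 \<rho> \<longlongrightarrow> 0) (at_left t0)" if "T0 = t0"
  proof (rule tendsto_sandwich)
    have ev: "eventually (\<lambda>t. 0 < t \<and> t < t0) (at_left t0)"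
      using eventually_at_left_real[OF t0_pos] by simp
    show "eventually (\<lambda>t. 0 \<le> \<mu>0 \<rho> t) (at_left t0)"
      using ev by eventually_elim (use \<mu>0_pos that in \<open>auto intro: less_imp_le\<close>)
    show "eventually (\<lambda>t. \<mu>0 \<rho> t \<le> U t) (at_left t0)"
      using ev by eventually_elim (use upper that T0_T in auto)
    have "isCont U t0" unfolding U_def by (intro continuous_intros)
    then show "(U \<longlongrightarrow> 0) (at_left t0)"
      using U_t0 by (simp add: isCont_def filterlim_at_split)
  qed simp
  define d where "d = ess_inf_on {0<..<t0} (deriv f)"
  obtain Kf where "Kf-lipschitz_on {0..t0} f" using f_lip t0_pos by blast
  then obtain d' where "\<And>t. t \<in> {0<..<t0} \<Longrightarrow> d' \<le> deriv f t"
    using deriv_lower_bound_of_lipschitz by blast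
  then have d_le: "AE t in lborel. t \<in> {0<..<t0} \<longrightarrow> d \<le> deriv f t"
    unfolding d_def using t0_pos by (intro ess_inf_on_le_AE[where c = d']) auto
  have bound: "AE a in lborel. 0 < a \<longrightarrow>
            v t a \<ge> \<gamma>6 * ln (1 + min t (\<epsilon> * a) / (t0 - t)) \<and>
            (\<epsilon> \<le> 1 \<longrightarrow> v t a \<ge> \<epsilon> * \<gamma>6 * ln (1 + min t (\<epsilon> * a) / (t0 - t)))"
    if t: "t \<in> {0<..<t0} \<inter> {0<..<T0}" for t
  proof -
    have t': "0 < t" "t < T0" "t \<le> T" "t < t0" using t T0_T by auto
    have ln_nonneg: "0 \<le> ln (1 + min t (\<epsilon> * a) / (t0 - t))" if "0 < a" for a
      using that t' eps by (intro ln_ge_zero) simp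
    have v_nn: "AE a in lborel. 0 < a \<longrightarrow> 0 \<le> v t a"
      by (rule v_nonneg) (use t' in auto)
    have \<gamma>: "\<gamma>6 = t0 * d / \<mu>0 \<rho> 0" by (simp add: \<gamma>6 d_def)
    show ?thesis
    \<comment> \<open>If \<open>t0\<close> exceeds \<open>T\<close>, the derivative of
      \<open>f\<close> may be negative between them, and so may \<open>d\<close>. In that case
      \<open>\<gamma>6 \<le> 0\<close> and both bounds follow from \<open>v \<ge> 0\<close>.\<close>
    proof (cases "0 \<le> d")
      case True
      have \<gamma>_nonneg: "0 \<le> \<gamma>6" using True t0_pos M by (simp add: \<gamma> M_def)
      have "AE a in lborel. 0 < a \<longrightarrow> \<gamma>6 * ln (1 + min t (\<epsilon> * a) / (t0 - t)) \<le> v t a"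
      proof (rule v_lower[OF t' True _ _ \<gamma>])
        show "AE \<tau> in lborel. \<tau> \<in> {0<..<t} \<longrightarrow> d \<le> deriv f \<tau>"
          using d_le by eventually_elim (use t' in auto)
        fix \<tau> assume \<tau>: "\<tau> \<in> {0<..<t}"
        then have "\<mu>0 \<rho> \<tau> \<le> U \<tau>" using t' by (intro upper) auto
        also have "\<dots> \<le> M * (1 - \<tau> / t0)" using \<tau> t' by (intro U_le) auto
        finally show "\<mu>0 \<rho> \<tau> \<le> \<mu>0 \<rho> 0 * (1 - \<tau> / t0)" by (simp add: M_def)
      qed
      then show ?thesis
      proof eventually_elim
        case (elim a)
        show ?case
        proof
          assume a: "0 < a"
          let ?l = "ln (1 + min t (\<epsilon> * a) / (t0 - t))"
          \<comment> \<open>For \<open>\<epsilon> \<le> 1\<close> the extra factor \<epsilon> only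
            weakens the bound, because \<open>\<gamma>6\<close> and the logarithm are nonnegative
            here.\<close>
          have "\<epsilon> * \<gamma>6 * ?l \<le> 1 * (\<gamma>6 * ?l)" if "\<epsilon> \<le> 1"
            unfolding mult.assoc using that \<gamma>_nonneg ln_nonneg[OF a] by (intro mult_right_mono) auto
          then show "v t a \<ge> \<gamma>6 * ?l \<and> (\<epsilon> \<le> 1 \<longrightarrow> v t a \<ge> \<epsilon> * \<gamma>6 * ?l)"
            using elim a by auto
        qed
      qed
    next
      case False
      then have \<gamma>_neg: "\<gamma>6 \<le> 0" using t0_pos M
        by (simp add: \<gamma> M_def divide_nonpos_pos mult_nonneg_nonpos)
      show ?thesis using v_nn
      proof eventually_elim
        case (elim a)
        show ?case
        proof
          assume a: "0 < a"
          let ?l = "ln (1 + min t (\<epsilon> * a) / (t0 - t))"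
          have "\<gamma>6 * ?l \<le> 0" using \<gamma>_neg ln_nonneg[OF a] by (rule mult_nonpos_nonneg)
          moreover from this have "\<epsilon> * (\<gamma>6 * ?l) \<le> 0" by (rule mult_nonneg_nonpos[OF less_imp_le[OF eps]])
          ultimately show "v t a \<ge> \<gamma>6 * ?l \<and> (\<epsilon> \<le> 1 \<longrightarrow> v t a \<ge> \<epsilon> * \<gamma>6 * ?l)"
            using elim a by (simp add: mult.assoc)
        qed
      qed
    qed
  qed
  show ?thesis
    using T0_le limit bound by blast
qed

end
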